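(* Let $\mathcal{S}_3=\{\mathcal{B}_3,[\mathcal{SD}]_3,[\mathcal{P}]_3,[\mathcal{PN}]_3,[\mathcal{SDP}]_3,[\langle\mathcal{M}\rangle_\omega]_3,[\mathcal{H}_{\mathrm{ferro}}]_3,[\mathcal{I}_{\mathrm{ferro}}]_3\}$. Then $[\mathcal{SDP}]_3=[\langle\mathcal{M}\rangle_\omega]_3$, $[\mathcal{H}_{\mathrm{ferro}}]_3=[\mathcal{I}_{\mathrm{ferro}}]_3$, and any other two elements of $\mathcal{S}_3$ are distinct.
   Context: $\mathcal{B}_k$ is the set of functions $\{0,1\}^k\to\mathbb{R}_{\ge0}$, $\mathcal{B}=\bigcup_k\mathcal{B}_k$, and for $\mathcal{F}\subseteq\mathcal{B}$, $[\mathcal{F}]_3=\mathcal{F}\cap\mathcal{B}_3$. $\mathrm{EQ}$ is the binary equality indicator. $\langle\mathcal{F}\rangle$ is the closure of $\mathcal{F}\cup\{\mathrm{EQ}\}$ under introducing fictitious arguments, permuting arguments, pointwise product of equal-arity functions, and summing out an argument over $\{0,1\}$; a $k$-ary $f$ is a limit of $\mathcal{F}$ if there is a finite $S\subseteq\mathcal{F}$ such that for all $\epsilon>0$ some $k$-ary $f_\epsilon\in\langle S\rangle$ has $\max_\mathbf{x}|f-f_\epsilon|<\epsilon$; $\langle\mathcal{F}\rangle_\omega$ is the closure of $\mathcal{F}\cup\{\mathrm{EQ}\}$ under the four operations and limits. $|\mathbf{x}|$ is Hamming weight and $\overline{\mathbf{x}}$ bitwise complement. Fourier transform: $\widehat f(\mathbf{x})=2^{-k}\sum_{\mathbf{w}}(-1)^{|\mathbf{w}\wedge\mathbf{x}|}f(\mathbf{w})$.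 $\mathrm{Ising}_k^\lambda\in\mathcal{B}_k$ ($\lambda\ge0$) is 1 on the all-0 and all-1 tuples and $\lambda$ elsewhere. A match-circuit of arity $k$: undirected graph with external degree-1 vertices $u_1,\dots,u_k$ whose incident edges $y_1,\dots,y_k$ (terminals) have weight 1, internal vertices $v_1,\dots,v_n$ ($n\ge k$), and positive weights on other edges; it implements $f(y_1,\dots,y_k)=\sum_H\prod_{e\in H}w_e$ over edge sets $H$ containing exactly the terminals set to 1 and covering each internal vertex exactly once. Sets: $\mathcal{SD}=\{f: f(\mathbf{x})=f(\overline{\mathbf{x}})\}$; $\mathcal{P}=\{f:\widehat f\ge0\}$; $\mathcal{PN}=\{f:\widehat f(\mathbf{x})\ge0$ for $|\mathbf{x}|$ even, $\le0$ for $|\mathbf{x}|$ odd$\}$; $\mathcal{SDP}=\mathcal{SD}\cap\mathcal{P}\cap\mathcal{PN}$; $\mathcal{M}=\{f\in\mathcal{B}:\widehat f$ implemented by a match-circuit$\}$; $\mathcal{I}_{\mathrm{ferro}}=\langle\{\mathrm{Ising}_2^\lambda:0\le\lambda\le1\}\cup\mathcal{B}_0\rangle_\omega$; $\mathcal{H}_{\mathrm{ferro}}=\langle\{\mathrm{Ising}_k^\lambda:k\ge2,0\le\lambda\le1\}\cup\mathcal{B}_0\rangle_\omega$. *)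

theory Defs
  imports Complex_Main "HOL-Library.FuncSet" "HOL-Combinatorics.Permutations"
begin

section \<open>Nonnegative functions of Boolean arguments\<close>

text \<open>A $k$-ary function is the pair of its arity and a map that is extensional on the bit lists of
  length $k$, so that HOL equality is equality of functions and functions of different
  arities are never identified. Arguments are numbered from 0.\<close>

type_synonym bfun = "nat \<times> (bool list \<Rightarrow> real)"

definition bits :: "nat \<Rightarrow> bool list set" where
  "bits k = {x. length x = k}"

definition mk_bfun :: "nat \<Rightarrow> (bool list \<Rightarrow> real) \<Rightarrow> bfun" where
  "mk_bfun k f = (k, restrict f (bits k))"

definition B_ar :: "nat \<Rightarrow> bfun set" where
  "B_ar k = {k} \<times> (bits k \<rightarrow>\<^sub>E {0..})"

definition B_all :: "bfun set" where
  "B_all = (\<Union>k. B_ar k)"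

definition ternary :: "bfun set \<Rightarrow> bfun set" where
  "ternary F = F \<inter> B_ar 3"

definition EQ :: bfun where
  "EQ = mk_bfun 2 (\<lambda>x. if x ! 0 = x ! 1 then 1 else 0)"

definition Ising :: "nat \<Rightarrow> real \<Rightarrow> bfun" where
  "Ising k l = mk_bfun k (\<lambda>x. if x = replicate k False \<or> x = replicate k True then 1 else l)"


section \<open>Functional clones\<close>

text \<open>The new argument of \<open>add_arg i f\<close> is put at position \<open>i\<close>.\<close>

definition add_arg :: "nat \<Rightarrow> bfun \<Rightarrow> bfun" where
  "add_arg i f = mk_bfun (Suc (fst f)) (\<lambda>x. snd f (take i x @ drop (Suc i) x))"

definition permute_args :: "(nat \<Rightarrow> nat) \<Rightarrow> bfun \<Rightarrow> bfun" where
  "permute_args p f = mk_bfun (fst f) (\<lambda>x. snd f (map (\<lambda>i. x ! p i) [0..<fst f]))"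

definition mult_bfun :: "bfun \<Rightarrow> bfun \<Rightarrow> bfun" where
  "mult_bfun f g = mk_bfun (fst f) (\<lambda>x. snd f x * snd g x)"

definition sum_arg :: "nat \<Rightarrow> bfun \<Rightarrow> bfun" where
  "sum_arg i f = mk_bfun (fst f - 1) (\<lambda>x. \<Sum>b\<in>UNIV. snd f (take i x @ b # drop i x))"

inductive_set clone :: "bfun set \<Rightarrow> bfun set" for F where
  base: "f \<in> F \<Longrightarrow> f \<in> clone F"
| eq: "EQ \<in> clone F"
| add: "f \<in> clone F \<Longrightarrow> i \<le> fst f \<Longrightarrow> add_arg i f \<in> clone F"
| permute: "f \<in> clone F \<Longrightarrow> p permutes {..<fst f} \<Longrightarrow> permute_args p f \<in> clone F"
| mult: "f \<in> clone F \<Longrightarrow> g \<in> clone F \<Longrightarrow> fst f = fst g \<Longrightarrow> mult_bfun f g \<in> clone F"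
| sum: "f \<in> clone F \<Longrightarrow> i < fst f \<Longrightarrow> sum_arg i f \<in> clone F"

text \<open>The finite set \<open>S\<close> is chosen before \<open>\<epsilon>\<close>. The maximum over the finite nonempty set of inputs is
  below \<open>\<epsilon>\<close> iff all the differences are.\<close>

definition limit_of :: "bfun \<Rightarrow> bfun set \<Rightarrow> bool" where
  "limit_of f F \<longleftrightarrow> f \<in> B_all \<and>
     (\<exists>S. finite S \<and> S \<subseteq> F \<and>
        (\<forall>\<epsilon>>0. \<exists>g \<in> clone S. fst g = fst f \<and> (\<forall>x\<in>bits (fst f). \<bar>snd f x - snd g x\<bar> < \<epsilon>)))"

lemma limit_of_mono [mono]: "(\<And>x. p x \<longrightarrow> q x) \<Longrightarrow> limit_of f {x. p x} \<longrightarrow> limit_of f {x. q x}"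
  unfolding limit_of_def by blast

inductive_set clone_omega :: "bfun set \<Rightarrow> bfun set" for F where
  base: "f \<in> F \<Longrightarrow> f \<in> clone_omega F"
| eq: "EQ \<in> clone_omega F"
| add: "f \<in> clone_omega F \<Longrightarrow> i \<le> fst f \<Longrightarrow> add_arg i f \<in> clone_omega F"
| permute: "f \<in> clone_omega F \<Longrightarrow> p permutes {..<fst f} \<Longrightarrow> permute_args p f \<in> clone_omega F"
| mult: "f \<in> clone_omega F \<Longrightarrow> g \<in> clone_omega F \<Longrightarrow> fst f = fst g \<Longrightarrow> mult_bfun f g \<in> clone_omega F"
| sum: "f \<in> clone_omega F \<Longrightarrow> i < fst f \<Longrightarrow> sum_arg i f \<in> clone_omega F"
| limit: "limit_of f (clone_omega F) \<Longrightarrow> f \<in> clone_omega F"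


section \<open>Match-circuits\<close>

datatype mvertex = External nat | Internal nat

text \<open>A simple graph on the external vertices $u_i$ ($i < k$) and the internal vertices $v_j$
  ($j < n$), with edges as two-element sets; \<open>y i\<close> is the terminal at $u_i$. The terminals are
  $k$ different edges, so no edge joins two external vertices.\<close>

definition match_circuit ::
  "nat \<Rightarrow> nat \<Rightarrow> mvertex set set \<Rightarrow> (nat \<Rightarrow> mvertex set) \<Rightarrow> (mvertex set \<Rightarrow> real) \<Rightarrow> bool" where
  "match_circuit k n E y w \<longleftrightarrow>
     k \<le> n \<and>
     (\<forall>e\<in>E. e \<subseteq> External ` {..<k} \<union> Internal ` {..<n} \<and> card e = 2) \<and>
     (\<forall>i<k. {e \<in> E. External i \<in> e} = {y i}) \<and>
     inj_on y {..<k} \<and>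
     (\<forall>i<k. w (y i) = 1) \<and>
     (\<forall>e \<in> E - y ` {..<k}. w e > 0)"

definition circuit_value ::
  "nat \<Rightarrow> nat \<Rightarrow> mvertex set set \<Rightarrow> (nat \<Rightarrow> mvertex set) \<Rightarrow> (mvertex set \<Rightarrow> real) \<Rightarrow> bool list \<Rightarrow> real" where
  "circuit_value k n E y w x =
     (\<Sum>H | H \<subseteq> E \<and> (\<forall>i<k. y i \<in> H \<longleftrightarrow> x ! i) \<and> (\<forall>j<n. \<exists>!e. e \<in> H \<and> Internal j \<in> e).
        \<Prod>e\<in>H. w e)"

definition match_implements :: "nat \<Rightarrow> (bool list \<Rightarrow> real) \<Rightarrow> bool" where
  "match_implements k f \<longleftrightarrow>
     (\<exists>n E y w. match_circuit k n E y w \<and> (\<forall>x\<in>bits k. f x = circuit_value k n E y w x))"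


section \<open>The classes of functions\<close>

definition hamming_weight :: "bool list \<Rightarrow> nat" where
  "hamming_weight x = count_list x True"

definition fourier :: "bfun \<Rightarrow> bool list \<Rightarrow> real" where
  "fourier f x =
     (\<Sum>w\<in>bits (fst f). (-1) ^ hamming_weight (map2 (\<and>) w x) * snd f w) / 2 ^ fst f"

definition class_SD :: "bfun set" where
  "class_SD = {f \<in> B_all. \<forall>x\<in>bits (fst f). snd f x = snd f (map Not x)}"

definition class_P :: "bfun set" where
  "class_P = {f \<in> B_all. \<forall>x\<in>bits (fst f). fourier f x \<ge> 0}"

definition class_PN :: "bfun set" where
  "class_PN = {f \<in> B_all. \<forall>x\<in>bits (fst f).
     (even (hamming_weight x) \<longrightarrow> fourier f x \<ge> 0) \<and> (odd (hamming_weight x) \<longrightarrow> fourier f x \<le> 0)}"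

definition class_SDP :: "bfun set" where
  "class_SDP = class_SD \<inter> class_P \<inter> class_PN"

definition class_M :: "bfun set" where
  "class_M = {f \<in> B_all. match_implements (fst f) (fourier f)}"

definition I_ferro :: "bfun set" where
  "I_ferro = clone_omega ({Ising 2 l | l. 0 \<le> l \<and> l \<le> 1} \<union> B_ar 0)"

definition H_ferro :: "bfun set" where
  "H_ferro = clone_omega ({Ising k l | k l. 2 \<le> k \<and> 0 \<le> l \<and> l \<le> 1} \<union> B_ar 0)"

end

theory Submission
  imports Defs
begin

text \<open>A self-dual function has Fourier transform supported on the inputs of even weight, so
  $\mathcal{SDP} = \mathcal{SD} \cap \mathcal{P}$, and this class is closed under all operations
  (products turn into convolutions) and contains $\mathcal{M}$ because matchings have a fixed parity.
  Conversely, a ternary function in $\mathcal{SDP}$ has only four nonzero Fourier coefficients, which a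
  weighted $K_4$ realises, unless the function is constant.

  All functions in $\mathcal{H}_{\mathrm{ferro}}$ are self-dual and log-supermodular; closure of
  log-supermodularity under summation is the one-bit case of the four functions theorem. A ternary
  function with both properties is a constant times a triangle of binary Ising functions.\<close>

text \<open>A derivation of a ternary function may pass through functions of any arity and through
  limits. The upper bounds therefore need invariants stated for all arities and given by equations
  or weak inequalities, which survive pointwise limits. The converse inclusions are exact
  constructions special to arity 3. The K_4 arises as follows. The free Fourier coefficients sit at
  000, 011, 101, 110, so by parity the number of internal vertices must be even, and a fourth vertex
  joins the three that carry terminals. The spoke weights b_i are then the coefficients of weight
  two, and the rim weights r_i have to satisfy sum_i b_i r_i = a, where a is the coefficient at 000.
  This is solvable in nonnegative reals unless all b_i vanish and a > 0; such constants come from a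
  nullary circuit instead. For the triangle, self-duality leaves one value p at 000 and values q, r,
  s at 001, 010, 100. Solving for the edge parameters when all are positive gives squares such as r
  s / (p q), and log-supermodularity makes these at most 1.\<close>

section \<open>Bit lists: insertion, deletion and permutation of positions\<close>

lemma finite_bits [simp]: "finite (bits k)"
  using finite_lists_length_eq[of "UNIV :: bool set" k] by (simp add: bits_def)

lemma bits_0 [simp]: "bits 0 = {[]}"
  by (auto simp: bits_def)

lemma bits_3 [simp]: "[x, y, z] \<in> bits 3"
  by (simp add: bits_def)

lemma replicate_bits [simp]: "replicate k b \<in> bits k"
  by (simp add: bits_def)

lemma ex_bits_2: "x \<in> bits 2 \<longleftrightarrow> (\<exists>a b. x = [a, b])"
  by (auto simp: bits_def numeral_2_eq_2 length_Suc_conv)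

lemma ex_bits_3: "x \<in> bits 3 \<longleftrightarrow> (\<exists>a b c. x = [a, b, c])"
  by (auto simp: bits_def numeral_3_eq_3 length_Suc_conv)

text \<open>These two are the list expressions inside \<open>sum_arg\<close> and
  \<open>add_arg\<close>; they are mutually inverse up to the bit at position
  \<open>i\<close>.\<close>

definition ins :: "nat \<Rightarrow> bool \<Rightarrow> bool list \<Rightarrow> bool list" where
  "ins i b w = take i w @ b # drop i w"

definition del :: "nat \<Rightarrow> bool list \<Rightarrow> bool list" where
  "del i w = take i w @ drop (Suc i) w"

lemma ins_del: "i < length w \<Longrightarrow> ins i (w ! i) (del i w) = w"
  by (simp add: ins_def del_def id_take_nth_drop[symmetric])

lemma del_ins: "i \<le> length w \<Longrightarrow> del i (ins i b w) = w"
  by (simp add: ins_def del_def)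

lemma nth_ins: "i \<le> length w \<Longrightarrow> ins i b w ! i = b"
  by (simp add: ins_def nth_append)

lemma length_ins: "i \<le> length w \<Longrightarrow> length (ins i b w) = Suc (length w)"
  by (simp add: ins_def)

lemma length_del: "i < length w \<Longrightarrow> length (del i w) = length w - 1"
  by (simp add: del_def)

text \<open>A list of length \<open>Suc k\<close> is the same as its bit at position
  \<open>i\<close> together with the remaining \<open>k\<close> bits. The position is arbitrary
  because arguments are added and summed out anywhere.\<close>

lemma sum_bits_Suc:
  assumes "i \<le> k"
  shows "(\<Sum>w\<in>bits (Suc k). F w) = (\<Sum>w\<in>bits k. \<Sum>b\<in>UNIV. F (ins i b w))"
proof -
  have "(\<Sum>w\<in>bits k. \<Sum>b\<in>UNIV. F (ins i b w)) = (\<Sum>(w, b)\<in>bits k \<times> UNIV. F (ins i b w))"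
    by (simp add: sum.cartesian_product)
  also have "\<dots> = (\<Sum>w\<in>bits (Suc k). F w)"
    by (rule sum.reindex_bij_witness[where i = "\<lambda>w. (del i w, w ! i)" and j = "\<lambda>(w, b). ins i b w"])
      (use assms in \<open>auto simp: bits_def ins_del del_ins nth_ins length_ins length_del\<close>)
  finally show ?thesis ..
qed

lemma map2_ins:
  "length x = length y \<Longrightarrow> map2 h (ins i a x) (ins i b y) = ins i (h a b) (map2 h x y)"
  by (simp add: ins_def take_map drop_map take_zip drop_zip)

lemma map2_del:
  "length x = length y \<Longrightarrow> map2 h (del i x) (del i y) = del i (map2 h x y)"
  by (simp add: del_def take_map drop_map take_zip drop_zip)

lemma map_ins: "map h (ins i a x) = ins i (h a) (map h x)"
  by (simp add: ins_def take_map drop_map)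

lemma map_del: "map h (del i x) = del i (map h x)"
  by (simp add: del_def take_map drop_map)

definition perm :: "(nat \<Rightarrow> nat) \<Rightarrow> bool list \<Rightarrow> bool list" where
  "perm p x = map (\<lambda>i. x ! p i) [0..<length x]"

lemma length_perm [simp]: "length (perm p x) = length x"
  by (simp add: perm_def)

lemma nth_perm [simp]: "i < length x \<Longrightarrow> perm p x ! i = x ! p i"
  by (simp add: perm_def)

lemma permutes_less: "p permutes {..<k} \<Longrightarrow> i < k \<Longrightarrow> p i < k"
  using permutes_in_image[of p "{..<k}" i] by simp

lemma map_perm: "p permutes {..<length x} \<Longrightarrow> map h (perm p x) = perm p (map h x)"
  by (rule nth_equalityI) (simp_all add: permutes_less)

lemma map2_perm:
  "length x = length y \<Longrightarrow> p permutes {..<length x} \<Longrightarrow>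
    map2 h (perm p x) (perm p y) = perm p (map2 h x y)"
  by (rule nth_equalityI) (simp_all add: permutes_less)

lemma perm_inverse:
  "p permutes {..<length x} \<Longrightarrow> perm p (perm (inv p) x) = x"
  "p permutes {..<length x} \<Longrightarrow> perm (inv p) (perm p x) = x"
  by (auto intro!: nth_equalityI simp: permutes_less permutes_inv permutes_inverses)

lemma sum_bool: "(\<Sum>b\<in>UNIV. F b) = F False + F True"
  by (simp add: UNIV_bool add.commute)


section \<open>Invariants of \<open>\<omega>\<close>-clones\<close>

lemma fst_mk_bfun [simp]: "fst (mk_bfun k f) = k"
  by (simp add: mk_bfun_def)

lemma snd_mk_bfun [simp]: "x \<in> bits k \<Longrightarrow> snd (mk_bfun k f) x = f x"
  by (simp add: mk_bfun_def)

lemma fst_add_arg [simp]: "fst (add_arg i f) = Suc (fst f)"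
  by (simp add: add_arg_def)

lemma fst_permute_args [simp]: "fst (permute_args p f) = fst f"
  by (simp add: permute_args_def)

lemma fst_mult_bfun [simp]: "fst (mult_bfun f g) = fst f"
  by (simp add: mult_bfun_def)

lemma fst_sum_arg [simp]: "fst (sum_arg i f) = fst f - 1"
  by (simp add: sum_arg_def)

lemma snd_add_arg [simp]: "x \<in> bits (Suc (fst f)) \<Longrightarrow> snd (add_arg i f) x = snd f (del i x)"
  by (simp add: add_arg_def del_def)

lemma snd_permute_args [simp]:
  "x \<in> bits (fst f) \<Longrightarrow> snd (permute_args p f) x = snd f (perm p x)"
  by (simp add: permute_args_def perm_def bits_def)

lemma snd_mult_bfun [simp]: "x \<in> bits (fst f) \<Longrightarrow> snd (mult_bfun f g) x = snd f x * snd g x"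
  by (simp add: mult_bfun_def)

lemma snd_sum_arg [simp]:
  "x \<in> bits (fst f - 1) \<Longrightarrow> snd (sum_arg i f) x = snd f (ins i False x) + snd f (ins i True x)"
  by (simp add: sum_arg_def sum_bool ins_def)

lemma B_all_iff: "f \<in> B_all \<longleftrightarrow> f \<in> B_ar (fst f)"
  by (auto simp: B_all_def B_ar_def)

lemma B_ar_iff:
  "f \<in> B_ar k \<longleftrightarrow> fst f = k \<and> snd f \<in> extensional (bits k) \<and> (\<forall>x\<in>bits k. 0 \<le> snd f x)"
  by (cases f) (auto simp: B_ar_def PiE_def Pi_def)

lemma extensional_mk_bfun [simp]: "snd (mk_bfun k f) \<in> extensional (bits k)"
  by (simp add: mk_bfun_def)

lemma mk_bfun_B_ar: "(\<And>x. x \<in> bits k \<Longrightarrow> 0 \<le> f x) \<Longrightarrow> mk_bfun k f \<in> B_ar k"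
  by (simp add: B_ar_iff)

lemma mk_bfun_B_all: "(\<And>x. x \<in> bits k \<Longrightarrow> 0 \<le> f x) \<Longrightarrow> mk_bfun k f \<in> B_all"
  by (simp add: B_all_iff mk_bfun_B_ar)

lemma B_all_nonneg: "f \<in> B_all \<Longrightarrow> x \<in> bits (fst f) \<Longrightarrow> 0 \<le> snd f x"
  by (simp add: B_all_iff B_ar_iff)

lemma bfun_eqI:
  "f \<in> B_ar k \<Longrightarrow> g \<in> B_ar k \<Longrightarrow> (\<And>x. x \<in> bits k \<Longrightarrow> snd f x = snd g x) \<Longrightarrow> f = g"
  by (auto simp: B_ar_iff intro!: prod_eqI extensionalityI[of _ "bits k"])

lemma fst_EQ [simp]: "fst EQ = 2"
  by (simp add: EQ_def)

lemma snd_EQ [simp]: "snd EQ [a, b] = (if a = b then 1 else 0)"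
  by (simp add: EQ_def ex_bits_2)

lemma B_all_EQ: "EQ \<in> B_all"
  unfolding EQ_def by (rule mk_bfun_B_all) simp

lemma ins_bits: "i < k \<Longrightarrow> x \<in> bits (k - 1) \<Longrightarrow> ins i b x \<in> bits k"
  by (auto simp: bits_def length_ins)

lemma del_bits: "i \<le> k \<Longrightarrow> x \<in> bits (Suc k) \<Longrightarrow> del i x \<in> bits k"
  by (auto simp: bits_def length_del)

lemma perm_bits [simp]: "perm p x \<in> bits k \<longleftrightarrow> x \<in> bits k"
  by (simp add: bits_def)

lemma B_all_add: "f \<in> B_all \<Longrightarrow> i \<le> fst f \<Longrightarrow> add_arg i f \<in> B_all"
  unfolding add_arg_def del_def[symmetric]
  by (rule mk_bfun_B_all) (simp add: B_all_nonneg del_bits)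

lemma B_all_permute: "f \<in> B_all \<Longrightarrow> permute_args p f \<in> B_all"
  unfolding permute_args_def
  by (rule mk_bfun_B_all) (simp add: B_all_nonneg bits_def)

lemma B_all_mult: "f \<in> B_all \<Longrightarrow> g \<in> B_all \<Longrightarrow> fst f = fst g \<Longrightarrow> mult_bfun f g \<in> B_all"
  unfolding mult_bfun_def by (rule mk_bfun_B_all) (simp add: B_all_nonneg)

lemma B_all_sum: "f \<in> B_all \<Longrightarrow> i < fst f \<Longrightarrow> sum_arg i f \<in> B_all"
  unfolding sum_arg_def ins_def[symmetric]
  by (rule mk_bfun_B_all) (simp add: sum_bool B_all_nonneg ins_bits)

text \<open>Closure is demanded only on \<open>B_all\<close>, because log-supermodularity needs
  nonnegative values for products and sums. Limits appear as pointwise convergent sequences, so that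
  the standard limit theorems apply.\<close>

locale omega_closed =
  fixes Q :: "bfun \<Rightarrow> bool"
  assumes EQ: "Q EQ"
    and add: "\<And>f i. f \<in> B_all \<Longrightarrow> Q f \<Longrightarrow> i \<le> fst f \<Longrightarrow> Q (add_arg i f)"
    and permute: "\<And>f p. f \<in> B_all \<Longrightarrow> Q f \<Longrightarrow> p permutes {..<fst f} \<Longrightarrow> Q (permute_args p f)"
    and mult: "\<And>f g. f \<in> B_all \<Longrightarrow> g \<in> B_all \<Longrightarrow> Q f \<Longrightarrow> Q g \<Longrightarrow> fst f = fst g \<Longrightarrow> Q (mult_bfun f g)"
    and sum: "\<And>f i. f \<in> B_all \<Longrightarrow> Q f \<Longrightarrow> i < fst f \<Longrightarrow> Q (sum_arg i f)"
    and limit: "\<And>f g. f \<in> B_all \<Longrightarrow> (\<And>n. Q (g n)) \<Longrightarrow> (\<And>n. fst (g n) = fst f) \<Longrightarrow>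
      (\<And>x. x \<in> bits (fst f) \<Longrightarrow> (\<lambda>n. snd (g n) x) \<longlonglongrightarrow> snd f x) \<Longrightarrow> Q f"
begin

lemma clone_subset:
  assumes F: "F \<subseteq> {f \<in> B_all. Q f}"
  shows "clone F \<subseteq> {f \<in> B_all. Q f}"
proof
  fix f assume "f \<in> clone F"
  then show "f \<in> {f \<in> B_all. Q f}"
    by induction (use F in \<open>auto intro: EQ add permute mult sum
      B_all_EQ B_all_add B_all_permute B_all_mult B_all_sum\<close>)
qed

lemma limit_closed:
  assumes "limit_of f F" and F: "F \<subseteq> {f \<in> B_all. Q f}"
  shows "f \<in> B_all \<and> Q f"
proof -
  obtain S where f: "f \<in> B_all" and "S \<subseteq> F" and S: "\<And>e. e > 0 \<Longrightarrow> \<exists>g \<in> clone S. fst g = fst f \<and>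
      (\<forall>x\<in>bits (fst f). \<bar>snd f x - snd g x\<bar> < e)"
    using assms(1) unfolding limit_of_def by blast
  \<comment> \<open>The errors 1 / (n + 1) turn the condition for all positive errors into a
    sequence.\<close>
  have "\<forall>n. \<exists>g \<in> clone S. fst g = fst f \<and> (\<forall>x\<in>bits (fst f). \<bar>snd f x - snd g x\<bar> < 1 / Suc n)"
    using S by simp
  then obtain g where g: "\<And>n. g n \<in> clone S" "\<And>n. fst (g n) = fst f"
    "\<And>n x. x \<in> bits (fst f) \<Longrightarrow> \<bar>snd f x - snd (g n) x\<bar> < 1 / Suc n"
    by metis
  \<comment> \<open>The approximants lie in the clone of \<open>S\<close>, not in \<open>S\<close>
    itself, so the invariant reaches them through the four operations.\<close>
  have "clone S \<subseteq> {f \<in> B_all. Q f}"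
    using clone_subset \<open>S \<subseteq> F\<close> F by blast
  then have "Q (g n)" for n
    using g(1) by blast
  moreover have "(\<lambda>n. snd (g n) x) \<longlonglongrightarrow> snd f x" if "x \<in> bits (fst f)" for x
  proof (rule LIMSEQ_I)
    fix r :: real assume "0 < r"
    then obtain N where N: "1 / real (Suc N) < r"
      using nat_approx_posE by blast
    have "norm (snd (g n) x - snd f x) < r" if "n \<ge> N" for n
    proof -
      have "1 / real (Suc n) \<le> 1 / real (Suc N)"
        using \<open>n \<ge> N\<close> by (simp add: frac_le)
      then show ?thesis
        using g(3)[OF \<open>x \<in> bits (fst f)\<close>, of n] N by (simp add: abs_minus_commute)
    qed
    then show "\<exists>no. \<forall>n\<ge>no. norm (snd (g n) x - snd f x) < r"
      by blast
  qed
  ultimately show ?thesis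
    using limit[OF f, of g] g(2) f by blast
qed

lemma clone_omega_subset:
  assumes F: "F \<subseteq> {f \<in> B_all. Q f}"
  shows "clone_omega F \<subseteq> {f \<in> B_all. Q f}"
proof
  fix f assume "f \<in> clone_omega F"
  then show "f \<in> {f \<in> B_all. Q f}"
  proof induction
    case (limit f)
    \<comment> \<open>The induction hypothesis makes \<open>f\<close> a limit of those members of
      the clone that already satisfy the invariant; it is only rewritten as an intersection.\<close>
    then have "limit_of f (clone_omega F \<inter> {f \<in> B_all. Q f})"
      by (simp add: Int_def)
    then show ?case
      using limit_closed by simp
  qed (use F in \<open>auto intro: EQ add permute mult sum
      B_all_EQ B_all_add B_all_permute B_all_mult B_all_sum\<close>)
qed

end

lemma clone_omega_mono:
  assumes "F \<subseteq> G"
  shows "clone_omega F \<subseteq> clone_omega G"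
proof
  fix f assume "f \<in> clone_omega F"
  then show "f \<in> clone_omega G"
  proof induction
    case (limit f)
    then have "limit_of f (clone_omega F \<inter> clone_omega G)"
      by (simp add: Int_def)
    then have "limit_of f (clone_omega G)"
      unfolding limit_of_def by blast
    then show ?case
      by (rule clone_omega.limit)
  qed (use assms in \<open>auto intro: clone_omega.intros\<close>)
qed


section \<open>Self-dual functions\<close>

definition self_dual :: "bfun \<Rightarrow> bool" where
  "self_dual f \<longleftrightarrow> (\<forall>x\<in>bits (fst f). snd f (map Not x) = snd f x)"

lemma class_SD_iff: "f \<in> class_SD \<longleftrightarrow> f \<in> B_all \<and> self_dual f"
  by (auto simp: class_SD_def self_dual_def)

lemma map_Not_bits [simp]: "map Not x \<in> bits k \<longleftrightarrow> x \<in> bits k"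
  by (simp add: bits_def)

interpretation self_dual: omega_closed self_dual
proof
  show "self_dual EQ"
    by (auto simp: self_dual_def ex_bits_2)
next
  fix f i assume "self_dual f" "i \<le> fst f"
  then show "self_dual (add_arg i f)"
    by (simp add: self_dual_def del_bits map_del[symmetric])
next
  fix f p assume "self_dual f" "p permutes {..<fst f}"
  then show "self_dual (permute_args p f)"
    by (simp add: self_dual_def bits_def map_perm[symmetric])
next
  fix f g assume "self_dual f" "self_dual g" "fst f = fst g"
  then show "self_dual (mult_bfun f g)"
    by (simp add: self_dual_def)
next
  fix f i assume f: "self_dual f" and i: "i < fst f"
  \<comment> \<open>Complementing the remaining arguments exchanges the two summands.\<close>
  have "snd f (ins i (\<not> b) (map Not x)) = snd f (ins i b x)" if "x \<in> bits (fst f - 1)" for x b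
    using f ins_bits[OF i that, of b] unfolding self_dual_def by (metis map_ins)
  from this[where b = True] this[where b = False] show "self_dual (sum_arg i f)"
    by (simp add: self_dual_def)
next
  fix f g assume Q: "\<And>n. self_dual (g n)" "\<And>n. fst (g n) = fst f"
    and lim: "\<And>x. x \<in> bits (fst f) \<Longrightarrow> (\<lambda>n. snd (g n) x) \<longlonglongrightarrow> snd f x"
  show "self_dual f"
    unfolding self_dual_def
  proof
    fix x assume x: "x \<in> bits (fst f)"
    then have "(\<lambda>n. snd (g n) (map Not x)) \<longlonglongrightarrow> snd f x"
      using Q lim[OF x] by (simp add: self_dual_def)
    moreover have "(\<lambda>n. snd (g n) (map Not x)) \<longlonglongrightarrow> snd f (map Not x)"
      using lim x by simp
    ultimately show "snd f (map Not x) = snd f x"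
      by (rule LIMSEQ_unique[symmetric])
  qed
qed


section \<open>Log-supermodular functions\<close>

definition lsm :: "bfun \<Rightarrow> bool" where
  "lsm f \<longleftrightarrow> (\<forall>x\<in>bits (fst f). \<forall>y\<in>bits (fst f).
     snd f x * snd f y \<le> snd f (map2 (\<and>) x y) * snd f (map2 (\<or>) x y))"

lemma lsmD:
  "lsm f \<Longrightarrow> x \<in> bits (fst f) \<Longrightarrow> y \<in> bits (fst f) \<Longrightarrow>
    snd f x * snd f y \<le> snd f (map2 (\<and>) x y) * snd f (map2 (\<or>) x y)"
  by (simp add: lsm_def)

lemma map2_bits: "x \<in> bits k \<Longrightarrow> y \<in> bits k \<Longrightarrow> map2 h x y \<in> bits k"
  by (simp add: bits_def)

text \<open>From (a - u)(a - v) \<ge> 0 follows a(u + v) \<le> a^2 + u v \<le> a(a + b), and a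
  cancels unless it is 0, in which case u = v = 0.\<close>

lemma add_le_add_of_mult_le:
  fixes u v a b :: real
  assumes "0 \<le> u" "u \<le> a" "0 \<le> v" "v \<le> a" "0 \<le> b" "u * v \<le> a * b"
  shows "u + v \<le> a + b"
proof (cases "a = 0")
  case False
  have "0 \<le> (a - u) * (a - v)"
    using assms by simp
  then have "a * (u + v) \<le> a * (a + b)"
    using assms(6) by (simp add: algebra_simps)
  then show ?thesis
    using False assms by (simp add: mult_le_cancel_left)
qed (use assms in auto)

text \<open>Expanding the product over both values of the summed bit gives two diagonal terms, each
  bounded by its own instance of log-supermodularity, and two mixed terms. Both mixed terms are
  bounded by the same term \<open>F False m * F True j\<close>, so they can only be handled
  together, by the preceding inequality.\<close>

lemma lsm_sum_arg:
  assumes B: "f \<in> B_all" and f: "lsm f" and i: "i < fst f"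
  shows "lsm (sum_arg i f)"
  unfolding lsm_def
proof (intro ballI)
  fix x y
  assume "x \<in> bits (fst (sum_arg i f))" "y \<in> bits (fst (sum_arg i f))"
  then have x: "x \<in> bits (fst f - 1)" and y: "y \<in> bits (fst f - 1)"
    by simp_all
  define F where "F b z = snd f (ins i b z)" for b z
  define m where "m = map2 (\<and>) x y"
  define j where "j = map2 (\<or>) x y"
  have mj: "m \<in> bits (fst f - 1)" "j \<in> bits (fst f - 1)"
    using x y by (simp_all add: m_def j_def map2_bits)
  have nonneg: "0 \<le> F b z" if "z \<in> bits (fst f - 1)" for b z
    using B_all_nonneg[OF B ins_bits[OF i that]] by (simp add: F_def)
  have le: "F a x * F b y \<le> F (a \<and> b) m * F (a \<or> b) j" for a b
    using lsmD[OF f ins_bits[OF i x] ins_bits[OF i y], of a b] x y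
    by (simp add: F_def m_def j_def map2_ins bits_def)
  \<comment> \<open>The product of the mixed terms equals that of the diagonal terms, which supplies
    the hypothesis u v \<le> a b.\<close>
  have "(F False x * F True y) * (F True x * F False y)
      = (F False x * F False y) * (F True x * F True y)"
    by (simp add: mult_ac)
  also have "\<dots> \<le> (F False m * F False j) * (F True m * F True j)"
    using le[of False False] le[of True True] nonneg x y mj
    by (intro mult_mono[where b = "F False m * F False j"]) auto
  finally have "F False x * F True y + F True x * F False y \<le> F False m * F True j + F True m * F False j"
    using le[of False True] le[of True False] nonneg x y mj
    by (intro add_le_add_of_mult_le) (auto simp: mult_ac)
  then have "(F False x + F True x) * (F False y + F True y) \<le> (F False m + F True m) * (F False j + F True j)"
    using le[of False False] le[of True True] by (simp add: algebra_simps)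
  then show "snd (sum_arg i f) x * snd (sum_arg i f) y
      \<le> snd (sum_arg i f) (map2 (\<and>) x y) * snd (sum_arg i f) (map2 (\<or>) x y)"
    using x y mj by (simp add: F_def m_def j_def)
qed

interpretation lsm: omega_closed lsm
proof
  show "lsm EQ"
    by (auto simp: lsm_def ex_bits_2)
next
  fix f i assume f: "lsm f" and i: "i \<le> fst f"
  show "lsm (add_arg i f)"
    unfolding lsm_def
  proof (intro ballI)
    fix x y assume "x \<in> bits (fst (add_arg i f))" "y \<in> bits (fst (add_arg i f))"
    then have xy: "x \<in> bits (Suc (fst f))" "y \<in> bits (Suc (fst f))"
      by simp_all
    then have "map2 h (del i x) (del i y) = del i (map2 h x y)" for h
      by (simp add: map2_del bits_def)
    then show "snd (add_arg i f) x * snd (add_arg i f) y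
        \<le> snd (add_arg i f) (map2 (\<and>) x y) * snd (add_arg i f) (map2 (\<or>) x y)"
      using lsmD[OF f del_bits[OF i xy(1)] del_bits[OF i xy(2)]] xy by (simp add: map2_bits)
  qed
next
  fix f p assume f: "lsm f" and p: "p permutes {..<fst f}"
  show "lsm (permute_args p f)"
    unfolding lsm_def
  proof (intro ballI)
    fix x y assume "x \<in> bits (fst (permute_args p f))" "y \<in> bits (fst (permute_args p f))"
    then have xy: "x \<in> bits (fst f)" "y \<in> bits (fst f)"
      by simp_all
    then have "map2 h (perm p x) (perm p y) = perm p (map2 h x y)" for h
      using p by (simp add: map2_perm bits_def)
    then show "snd (permute_args p f) x * snd (permute_args p f) y
        \<le> snd (permute_args p f) (map2 (\<and>) x y) * snd (permute_args p f) (map2 (\<or>) x y)"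
      using lsmD[OF f, of "perm p x" "perm p y"] xy by (simp add: map2_bits)
  qed
next
  fix f g assume fg: "f \<in> B_all" "g \<in> B_all" "lsm f" "lsm g" "fst f = fst g"
  show "lsm (mult_bfun f g)"
    unfolding lsm_def
  proof (intro ballI)
    fix x y assume "x \<in> bits (fst (mult_bfun f g))" "y \<in> bits (fst (mult_bfun f g))"
    then have xy: "x \<in> bits (fst f)" "y \<in> bits (fst f)"
      by simp_all
    have "(snd f x * snd f y) * (snd g x * snd g y)
      \<le> (snd f (map2 (\<and>) x y) * snd f (map2 (\<or>) x y)) * (snd g (map2 (\<and>) x y) * snd g (map2 (\<or>) x y))"
      using fg xy by (intro mult_mono lsmD mult_nonneg_nonneg B_all_nonneg) (auto simp: map2_bits)
    then show "snd (mult_bfun f g) x * snd (mult_bfun f g) y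
      \<le> snd (mult_bfun f g) (map2 (\<and>) x y) * snd (mult_bfun f g) (map2 (\<or>) x y)"
      using xy by (simp add: map2_bits mult_ac)
  qed
next
  fix f i assume "f \<in> B_all" "lsm f" "i < fst f"
  then show "lsm (sum_arg i f)"
    by (rule lsm_sum_arg)
next
  fix f g assume Q: "\<And>n. lsm (g n)" "\<And>n. fst (g n) = fst f"
    and lim: "\<And>x. x \<in> bits (fst f) \<Longrightarrow> (\<lambda>n. snd (g n) x) \<longlonglongrightarrow> snd f x"
  show "lsm f"
    unfolding lsm_def
  proof (intro ballI)
    fix x y assume xy: "x \<in> bits (fst f)" "y \<in> bits (fst f)"
    have "snd (g n) x * snd (g n) y \<le> snd (g n) (map2 (\<and>) x y) * snd (g n) (map2 (\<or>) x y)" for n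
      using lsmD[OF Q(1), of x n y] xy by (simp add: Q(2))
    then show "snd f x * snd f y \<le> snd f (map2 (\<and>) x y) * snd f (map2 (\<or>) x y)"
      using xy by (intro LIMSEQ_le[OF tendsto_mult[OF lim lim] tendsto_mult[OF lim lim]])
        (auto simp: map2_bits)
  qed
qed



section \<open>Functions with nonnegative Fourier transform\<close>

text \<open>The character of the group (Z/2)^k indexed by \<open>x\<close>.\<close>

definition chr :: "bool list \<Rightarrow> bool list \<Rightarrow> real" where
  "chr x w = (-1) ^ hamming_weight (map2 (\<and>) w x)"

lemma hamming_weight_simps [simp]:
  "hamming_weight [] = 0"
  "hamming_weight (b # x) = (if b then Suc (hamming_weight x) else hamming_weight x)"
  by (simp_all add: hamming_weight_def)

lemma hamming_weight_card: "hamming_weight x = card {i. i < length x \<and> x ! i}"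
  by (simp add: hamming_weight_def count_list_eq_length_filter length_filter_conv_card)

lemma hamming_weight_ins:
  "hamming_weight (ins i b x) = (if b then Suc (hamming_weight x) else hamming_weight x)"
proof -
  have "hamming_weight x = hamming_weight (take i x) + hamming_weight (drop i x)"
    by (metis append_take_drop_id count_list_append hamming_weight_def)
  then show ?thesis
    by (simp add: ins_def hamming_weight_def)
qed

lemma chr_simps [simp]:
  "chr [] w = 1"
  "chr (a # x) (b # w) = (if a \<and> b then - chr x w else chr x w)"
  by (simp_all add: chr_def)

lemma chr_prod:
  "length x = length w \<Longrightarrow> chr x w = (\<Prod>i<length w. if x ! i \<and> w ! i then -1 else 1)"
  by (induction x w rule: list_induct2) (simp_all add: prod.lessThan_Suc_shift del: prod.lessThan_Suc)

lemma chr_commute: "length x = length w \<Longrightarrow> chr x w = chr w x"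
  by (induction x w rule: list_induct2) auto

lemma chr_ins:
  "length x = length w \<Longrightarrow> chr (ins i a x) (ins i b w) = (if a \<and> b then - chr x w else chr x w)"
  by (simp add: chr_def map2_ins hamming_weight_ins)

lemma chr_perm:
  assumes "length x = length w" "p permutes {..<length w}"
  shows "chr (perm p x) (perm p w) = chr x w"
proof -
  have "chr (perm p x) (perm p w) = (\<Prod>i<length w. if x ! p i \<and> w ! p i then -1 else 1)"
    using assms by (simp add: chr_prod)
  also have "\<dots> = chr x w"
    using prod.permute[OF assms(2), of "\<lambda>i. if x ! i \<and> w ! i then -1 else 1 :: real"] assms(1)
    by (simp add: chr_prod comp_def)
  finally show ?thesis .
qed

lemma chr_mult:
  "length x = length w \<Longrightarrow> length y = length w \<Longrightarrow> chr x w * chr y w = chr (map2 (\<noteq>) x y) w"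
  by (simp add: chr_prod prod.distrib[symmetric]) (rule prod.cong, auto)

text \<open>Each true bit of \<open>x\<close> contributes one sign change. This is the link between
  self-duality and the parity of the support of the transform.\<close>

lemma chr_Not:
  "length x = length w \<Longrightarrow> chr x (map Not w) = (-1) ^ hamming_weight x * chr x w"
  by (induction x w rule: list_induct2) auto

text \<open>Splitting on the leading bit of \<open>w\<close>: if the leading bit of \<open>x\<close>
  is true the two halves cancel, otherwise they agree.\<close>

lemma sum_chr: "x \<in> bits k \<Longrightarrow> (\<Sum>w\<in>bits k. chr x w) = (if x = replicate k False then 2 ^ k else 0)"
proof (induction k arbitrary: x)
  case (Suc k)
  then obtain a z where x: "x = a # z" "z \<in> bits k"
    by (auto simp: bits_def length_Suc_conv)
  have "(\<Sum>w\<in>bits (Suc k). chr x w) = (if a then 0 else 2 * (\<Sum>w\<in>bits k. chr z w))"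
    by (auto simp: sum_bits_Suc[of 0] sum_bool x ins_def sum_distrib_left intro: sum.cong)
  then show ?case
    using Suc.IH[OF x(2)] by (auto simp: x)
qed simp

lemma sum_chr_nonneg: "x \<in> bits k \<Longrightarrow> 0 \<le> (\<Sum>w\<in>bits k. chr x w)"
  by (simp add: sum_chr)

lemma chr_orthogonal:
  assumes "x \<in> bits k" "y \<in> bits k"
  shows "(\<Sum>w\<in>bits k. chr x w * chr y w) = (if x = y then 2 ^ k else 0)"
proof -
  have "(\<Sum>w\<in>bits k. chr x w * chr y w) = (\<Sum>w\<in>bits k. chr (map2 (\<noteq>) x y) w)"
    using assms by (intro sum.cong refl) (simp add: chr_mult bits_def)
  moreover have "map2 (\<noteq>) x y = replicate k False \<longleftrightarrow> x = y"
    using assms by (auto simp: bits_def list_eq_iff_nth_eq)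
  ultimately show ?thesis
    using sum_chr[of "map2 (\<noteq>) x y" k] assms by (simp add: map2_bits)
qed

lemma fourier_chr: "fourier f x = (\<Sum>w\<in>bits (fst f). chr x w * snd f w) / 2 ^ fst f"
  by (simp add: fourier_def chr_def)

lemma fourier_inversion:
  assumes w: "w \<in> bits (fst f)"
  shows "snd f w = (\<Sum>x\<in>bits (fst f). fourier f x * chr x w)"
proof -
  let ?X = "bits (fst f)"
  have "(\<Sum>x\<in>?X. fourier f x * chr x w) = (\<Sum>x\<in>?X. \<Sum>v\<in>?X. snd f v * (chr x v * chr x w)) / 2 ^ fst f"
    by (simp add: fourier_chr sum_divide_distrib sum_distrib_left sum_distrib_right mult_ac)
  also have "\<dots> = (\<Sum>v\<in>?X. snd f v * (\<Sum>x\<in>?X. chr x v * chr x w)) / 2 ^ fst f"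
    by (subst sum.swap) (simp add: sum_distrib_left)
  \<comment> \<open>Orthogonality sums over the second argument of \<open>chr\<close>, so the
    symmetry of \<open>chr\<close> moves \<open>x\<close> there.\<close>
  also have "\<dots> = (\<Sum>v\<in>?X. snd f v * (\<Sum>x\<in>?X. chr v x * chr w x)) / 2 ^ fst f"
    using w by (intro arg_cong2[of _ _ _ _ "(/)"] sum.cong arg_cong2[of _ _ _ _ "(*)"] refl chr_commute)
      (simp_all add: bits_def)
  also have "\<dots> = (\<Sum>v\<in>?X. if v = w then snd f v else 0)"
    using w by (simp add: chr_orthogonal sum_divide_distrib if_distrib cong: if_cong)
  finally show ?thesis
    using w by simp
qed

section \<open>Fourier coefficients under the clone operations\<close>

definition fpos :: "bfun \<Rightarrow> bool" where
  "fpos f \<longleftrightarrow> (\<forall>x\<in>bits (fst f). 0 \<le> fourier f x)"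

lemma class_P_iff: "f \<in> class_P \<longleftrightarrow> f \<in> B_all \<and> fpos f"
  by (simp add: class_P_def fpos_def)

text \<open>The function does not depend on the new bit, so coefficients that involve it cancel; for
  the others the doubled sum is absorbed by the larger normalising power of 2.\<close>

lemma fourier_add_arg:
  assumes i: "i \<le> fst f" and x: "x \<in> bits (Suc (fst f))"
  shows "fourier (add_arg i f) x = (if x ! i then 0 else fourier f (del i x))"
proof -
  have ix: "x = ins i (x ! i) (del i x)"
    using i x by (simp add: ins_del bits_def)
  have "(\<Sum>w\<in>bits (Suc (fst f)). chr x w * snd (add_arg i f) w)
      = (\<Sum>w\<in>bits (fst f). if x ! i then 0 else 2 * (chr (del i x) w * snd f w))"
    unfolding sum_bits_Suc[OF i]
  proof (rule sum.cong[OF refl])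
    fix w assume w: "w \<in> bits (fst f)"
    have "chr x (ins i b w) = (if x ! i \<and> b then - chr (del i x) w else chr (del i x) w)" for b
      by (subst ix, subst chr_ins) (use w del_bits[OF i x] in \<open>simp_all add: bits_def\<close>)
    moreover have "ins i b w \<in> bits (Suc (fst f))" for b
      using w i by (simp add: bits_def length_ins)
    ultimately show "(\<Sum>b\<in>UNIV. chr x (ins i b w) * snd (add_arg i f) (ins i b w))
        = (if x ! i then 0 else 2 * (chr (del i x) w * snd f w))"
      using w i by (simp add: sum_bool del_ins bits_def)
  qed
  then show ?thesis
    by (simp add: fourier_chr sum_distrib_left[symmetric])
qed

text \<open>Characters with a false bit at \<open>i\<close> ignore the summed argument. The factor 2
  comes from the normalisation.\<close>

lemma fourier_sum_arg:
  assumes i: "i < fst f" and x: "x \<in> bits (fst f - 1)"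
  shows "fourier (sum_arg i f) x = 2 * fourier f (ins i False x)"
proof -
  define k where "k = fst f - 1"
  have k: "fst f = Suc k" and "i \<le> k"
    using i by (simp_all add: k_def)
  have "(\<Sum>w\<in>bits (fst f). chr (ins i False x) w * snd f w)
      = (\<Sum>w\<in>bits k. chr x w * snd (sum_arg i f) w)"
    unfolding k sum_bits_Suc[OF \<open>i \<le> k\<close>]
  proof (rule sum.cong[OF refl])
    fix w assume w: "w \<in> bits k"
    then show "(\<Sum>b\<in>UNIV. chr (ins i False x) (ins i b w) * snd f (ins i b w))
        = chr x w * snd (sum_arg i f) w"
      using x by (simp add: sum_bool chr_ins bits_def k algebra_simps)
  qed
  then show ?thesis
    by (simp add: fourier_chr k)
qed

lemma fourier_permute_args:
  assumes p: "p permutes {..<fst f}" and x: "x \<in> bits (fst f)"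
  shows "fourier (permute_args p f) x = fourier f (perm p x)"
proof -
  have "(\<Sum>w\<in>bits (fst f). chr x w * snd (permute_args p f) w)
      = (\<Sum>w\<in>bits (fst f). chr (perm p x) w * snd f w)"
    by (rule sum.reindex_bij_witness[where i = "perm (inv p)" and j = "perm p"])
      (use p x in \<open>auto simp: bits_def perm_inverse chr_perm\<close>)
  then show ?thesis
    by (simp add: fourier_chr)
qed

text \<open>Expanding both factors by inversion writes a coefficient of the product as a double sum
  of products of coefficients, each weighted by a sum over three multiplied characters. These
  multiply to one character, whose sum is 0 or a power of 2.\<close>

lemma fpos_mult_bfun:
  assumes f: "fpos f" and g: "fpos g" and k: "fst f = fst g"
  shows "fpos (mult_bfun f g)"
  unfolding fpos_def
proof
  fix z assume "z \<in> bits (fst (mult_bfun f g))"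
  then have z: "z \<in> bits (fst f)"
    by simp
  let ?X = "bits (fst f)"
  have "(\<Sum>w\<in>?X. chr z w * snd (mult_bfun f g) w)
      = (\<Sum>w\<in>?X. \<Sum>x\<in>?X. \<Sum>y\<in>?X. fourier f x * fourier g y * (chr z w * chr x w * chr y w))"
  proof (rule sum.cong[OF refl])
    fix w assume w: "w \<in> ?X"
    then have "snd (mult_bfun f g) w
        = (\<Sum>x\<in>?X. fourier f x * chr x w) * (\<Sum>y\<in>?X. fourier g y * chr y w)"
      using fourier_inversion[of w f] fourier_inversion[of w g] k by simp
    then show "chr z w * snd (mult_bfun f g) w
        = (\<Sum>x\<in>?X. \<Sum>y\<in>?X. fourier f x * fourier g y * (chr z w * chr x w * chr y w))"
      by (simp only: sum_product) (simp add: sum_distrib_left mult_ac)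
  qed
  also have "\<dots> = (\<Sum>x\<in>?X. \<Sum>y\<in>?X. fourier f x * fourier g y * (\<Sum>w\<in>?X. chr z w * chr x w * chr y w))"
    by (rule trans[OF sum.swap], rule sum.cong[OF refl], rule trans[OF sum.swap])
      (simp add: sum_distrib_left)
  also have "\<dots> \<ge> 0"
  proof (rule sum_nonneg, rule sum_nonneg, rule mult_nonneg_nonneg, rule mult_nonneg_nonneg)
    fix x y assume x: "x \<in> ?X" and y: "y \<in> ?X"
    show "0 \<le> fourier f x" "0 \<le> fourier g y"
      using f g x y k by (simp_all add: fpos_def)
    have "(\<Sum>w\<in>?X. chr z w * chr x w * chr y w) = (\<Sum>w\<in>?X. chr (map2 (\<noteq>) (map2 (\<noteq>) z x) y) w)"
      using x y z by (intro sum.cong refl) (simp add: chr_mult bits_def)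
    moreover have "0 \<le> (\<Sum>w\<in>?X. chr (map2 (\<noteq>) (map2 (\<noteq>) z x) y) w)"
      using x y z by (intro sum_chr_nonneg map2_bits)
    ultimately show "0 \<le> (\<Sum>w\<in>?X. chr z w * chr x w * chr y w)"
      by simp
  qed
  finally show "0 \<le> fourier (mult_bfun f g) z"
    by (simp add: fourier_chr)
qed

lemma sum_bits_2:
  "(\<Sum>w\<in>bits 2. F w) = F [False, False] + F [False, True] + F [True, False] + F [True, True]"
  by (simp add: numeral_2_eq_2 sum_bits_Suc[of 0] sum_bool ins_def add_ac)

lemma sum_bits_3:
  "(\<Sum>w\<in>bits 3. F w) =
    F [False, False, False] + F [False, False, True] + F [False, True, False] + F [False, True, True] +
    F [True, False, False] + F [True, False, True] + F [True, True, False] + F [True, True, True]"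
  by (simp add: numeral_3_eq_3 sum_bits_Suc[of 0] sum_bool ins_def add_ac)

interpretation fpos: omega_closed fpos
proof
  show "fpos EQ"
    by (auto simp: fpos_def ex_bits_2 fourier_chr sum_bits_2)
next
  fix f i assume "fpos f" "i \<le> fst f"
  then show "fpos (add_arg i f)"
    by (simp add: fpos_def fourier_add_arg del_bits)
next
  fix f p assume "fpos f" "p permutes {..<fst f}"
  then show "fpos (permute_args p f)"
    by (simp add: fpos_def fourier_permute_args)
next
  fix f g assume "fpos f" "fpos g" "fst f = fst g"
  then show "fpos (mult_bfun f g)"
    by (rule fpos_mult_bfun)
next
  fix f i assume "fpos f" "i < fst f"
  then show "fpos (sum_arg i f)"
    by (simp add: fpos_def fourier_sum_arg ins_bits)
next
  fix f g assume Q: "\<And>n. fpos (g n)" "\<And>n. fst (g n) = fst f"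
    and lim: "\<And>x. x \<in> bits (fst f) \<Longrightarrow> (\<lambda>n. snd (g n) x) \<longlonglongrightarrow> snd f x"
  show "fpos f"
    unfolding fpos_def
  proof
    fix x assume x: "x \<in> bits (fst f)"
    \<comment> \<open>A coefficient is a finite linear combination of values, hence continuous in
      them.\<close>
    have "(\<lambda>n. fourier (g n) x) \<longlonglongrightarrow> fourier f x"
      unfolding fourier_chr Q(2) by (intro tendsto_intros lim) simp_all
    moreover have "0 \<le> fourier (g n) x" for n
      using Q x by (simp add: fpos_def)
    ultimately show "0 \<le> fourier f x"
      by (intro LIMSEQ_le_const) auto
  qed
qed

text \<open>Replacing \<open>w\<close> by its complement keeps the function value and negates the
  character, so the sum equals its own negative.\<close>

lemma fourier_self_dual_odd:
  assumes f: "self_dual f" and x: "x \<in> bits (fst f)" "odd (hamming_weight x)"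
  shows "fourier f x = 0"
proof -
  have "(\<Sum>w\<in>bits (fst f). chr x w * snd f w) = (\<Sum>w\<in>bits (fst f). chr x (map Not w) * snd f (map Not w))"
    by (rule sum.reindex_bij_witness[where i = "map Not" and j = "map Not"]) (auto simp: bits_def comp_def)
  also have "\<dots> = (\<Sum>w\<in>bits (fst f). - (chr x w * snd f w))"
    using f x by (intro sum.cong refl) (simp add: chr_Not self_dual_def bits_def)
  finally show ?thesis
    by (simp add: fourier_chr sum_negf)
qed

lemma class_SDP_iff: "f \<in> class_SDP \<longleftrightarrow> f \<in> B_all \<and> self_dual f \<and> fpos f"
  by (auto simp: class_SDP_def class_SD_iff class_P_iff class_PN_def fourier_self_dual_odd)
    (auto simp: fpos_def)


section \<open>Match-circuits\<close>

text \<open>Double counting: the n internal vertices are each covered once, and an edge covers one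
  of them if it is a terminal and two otherwise. Hence n is congruent modulo 2 to the number of
  terminals used.\<close>

lemma matching_parity:
  assumes C: "match_circuit k n E y w" and H: "H \<subseteq> E"
    and cover: "\<forall>j<n. \<exists>!e. e \<in> H \<and> Internal j \<in> e"
  shows "even (card {i. i < k \<and> y i \<in> H}) \<longleftrightarrow> even n"
proof -
  define I where "I = Internal ` {..<n}"
  define T where "T = y ` {..<k}"
  have edge: "e \<subseteq> External ` {..<k} \<union> I" "card e = 2" if "e \<in> E" for e
    using C that by (auto simp: match_circuit_def I_def)
  have y: "{e \<in> E. External i \<in> e} = {y i}" if "i < k" for i
    using C that by (simp add: match_circuit_def)
  have inj: "inj_on y {..<k}"
    using C by (simp add: match_circuit_def)
  have "E \<subseteq> Pow (External ` {..<k} \<union> I)"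
    using edge(1) by blast
  then have "finite E"
    by (rule finite_subset) (simp add: I_def)
  then have fin: "finite H"
    using H by (rule rev_finite_subset)
  have card_edge: "card (e \<inter> I) = (if e \<in> T then 1 else 2)" if e: "e \<in> E" for e
  proof (cases "e \<in> T")
    case True
    then obtain i where i: "i < k" "e = y i"
      by (auto simp: T_def)
    \<comment> \<open>A second external endpoint would make the edge the terminal of another index
      as well, contrary to injectivity of \<open>y\<close>.\<close>
    have "e - I = {External i}"
    proof (intro equalityI subsetI)
      fix v assume v: "v \<in> e - I"
      then obtain j where j: "j < k" "v = External j"
        using edge(1)[OF e] by blast
      then have "e = y j"
        using y[OF j(1)] e v by blast
      then show "v \<in> {External i}"
        using i j inj by (auto dest: inj_onD)
    qed (use y[OF i(1)] i in \<open>auto simp: I_def\<close>)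
    moreover have "card e = card (e \<inter> I) + card (e - I)"
      using edge(2)[OF e] by (subst card_Int_Diff) (auto intro: card_ge_0_finite)
    ultimately show ?thesis
      using edge(2)[OF e] True by simp
  next
    case False
    have "External i \<notin> e" if "i < k" for i
      using y[OF that] e False that by (auto simp: T_def)
    then have "e \<subseteq> I"
      using edge(1)[OF e] by blast
    then show ?thesis
      using edge(2)[OF e] False by (simp add: Int_absorb2)
  qed
  have "n = card I"
    by (simp add: I_def card_image inj_on_def)
  also have "I = (\<Union>e\<in>H. e \<inter> I)"
    using cover by (auto simp: I_def)
  \<comment> \<open>Unique covering makes the edges of \<open>H\<close> disjoint on
    \<open>I\<close>.\<close>
  also have "card \<dots> = (\<Sum>e\<in>H. card (e \<inter> I))"
    using fin cover by (intro card_UN_disjoint) (auto simp: I_def)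
  also have "\<dots> = (\<Sum>e\<in>H. if e \<in> T then 1 else 2)"
    using H card_edge by (intro sum.cong) auto
  also have "\<dots> = card (H \<inter> T) + 2 * card (H - T)"
    using fin by (simp add: sum.If_cases Diff_eq)
  also have "H \<inter> T = y ` {i. i < k \<and> y i \<in> H}"
    by (auto simp: T_def)
  also have "card \<dots> = card {i. i < k \<and> y i \<in> H}"
    using inj by (intro card_image) (auto intro: inj_on_subset)
  finally show ?thesis
    by simp
qed

lemma circuit_value_nonneg:
  assumes "match_circuit k n E y w"
  shows "0 \<le> circuit_value k n E y w x"
proof -
  have "0 \<le> w e" if "e \<in> E" for e
    using assms that by (cases "e \<in> y ` {..<k}") (auto simp: match_circuit_def less_imp_le)
  then show ?thesis
    unfolding circuit_value_def by (intro sum_nonneg prod_nonneg) auto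
qed

lemma circuit_value_parity:
  assumes C: "match_circuit k n E y w" and x: "x \<in> bits k" "even (hamming_weight x) \<noteq> even n"
  shows "circuit_value k n E y w x = 0"
proof -
  have "\<not> (H \<subseteq> E \<and> (\<forall>i<k. y i \<in> H \<longleftrightarrow> x ! i) \<and> (\<forall>j<n. \<exists>!e. e \<in> H \<and> Internal j \<in> e))" for H
  proof
    assume H: "H \<subseteq> E \<and> (\<forall>i<k. y i \<in> H \<longleftrightarrow> x ! i) \<and> (\<forall>j<n. \<exists>!e. e \<in> H \<and> Internal j \<in> e)"
    then have "{i. i < k \<and> y i \<in> H} = {i. i < length x \<and> x ! i}"
      using x by (auto simp: bits_def)
    then show False
      using matching_parity[OF C, of H] H x(2) by (simp add: hamming_weight_card)
  qed
  then have "{H. H \<subseteq> E \<and> (\<forall>i<k. y i \<in> H \<longleftrightarrow> x ! i) \<and> (\<forall>j<n. \<exists>!e. e \<in> H \<and> Internal j \<in> e)} = {}"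
    by (simp only: Collect_empty_eq simp_thms)
  then show ?thesis
    unfolding circuit_value_def by (simp only: sum.empty)
qed

text \<open>The parity of the number of internal vertices makes $\widehat f$ vanish on all inputs of one
  parity; if it vanishes on the even inputs, then $f(\overline w) = -f(w)$, so $f = 0$.\<close>

lemma class_M_subset: "class_M \<subseteq> {f \<in> B_all. self_dual f \<and> fpos f}"
proof
  fix f assume "f \<in> class_M"
  then obtain n E y w where B: "f \<in> B_all" and C: "match_circuit (fst f) n E y w"
    and val: "\<And>x. x \<in> bits (fst f) \<Longrightarrow> fourier f x = circuit_value (fst f) n E y w x"
    by (auto simp: class_M_def match_implements_def)
  have "fpos f"
    using val circuit_value_nonneg[OF C] by (simp add: fpos_def)
  moreover have "self_dual f"
    unfolding self_dual_def
  proof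
    fix v assume v: "v \<in> bits (fst f)"
    have "snd f (map Not v) = (\<Sum>x\<in>bits (fst f). fourier f x * chr x (map Not v))"
      using v by (simp add: fourier_inversion)
    also have "\<dots> = (\<Sum>x\<in>bits (fst f). (-1) ^ n * (fourier f x * chr x v))"
    proof (rule sum.cong[OF refl])
      fix x assume x: "x \<in> bits (fst f)"
      show "fourier f x * chr x (map Not v) = (-1) ^ n * (fourier f x * chr x v)"
      proof (cases "even (hamming_weight x) = even n")
        case True
        then have "(-1 :: real) ^ hamming_weight x = (-1) ^ n"
          by (cases "even n") auto
        then show ?thesis
          using x v by (simp add: chr_Not bits_def)
      next
        case False
        then show ?thesis
          using val[OF x] circuit_value_parity[OF C x] by simp
      qed
    qed
    also have "\<dots> = (-1) ^ n * snd f v"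
      using v by (simp add: fourier_inversion sum_distrib_left)
    finally have "snd f (map Not v) = (-1) ^ n * snd f v" .
    then show "snd f (map Not v) = snd f v"
      using B_all_nonneg[OF B v] B_all_nonneg[OF B, of "map Not v"] v
      by (cases "even n") auto
  qed
  ultimately show "f \<in> {f \<in> B_all. self_dual f \<and> fpos f}"
    using B by simp
qed

lemma clone_omega_M_subset: "clone_omega class_M \<subseteq> class_SDP"
proof -
  have "clone_omega class_M \<subseteq> {f \<in> B_all. self_dual f}" "clone_omega class_M \<subseteq> {f \<in> B_all. fpos f}"
    by (intro self_dual.clone_omega_subset fpos.clone_omega_subset subset_trans[OF class_M_subset]; blast)+
  then show ?thesis
    by (auto simp: class_SDP_iff)
qed

lemma circuit_value_superset:
  assumes "E \<subseteq> A" "finite A" "\<And>e. e \<in> A - E \<Longrightarrow> w e = 0"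
  shows "circuit_value k n E y w x = circuit_value k n A y w x"
  unfolding circuit_value_def
proof (rule sum.mono_neutral_left)
  show "finite {H. H \<subseteq> A \<and> (\<forall>i<k. (y i \<in> H) = x ! i) \<and> (\<forall>j<n. \<exists>!e. e \<in> H \<and> Internal j \<in> e)}"
    by (rule finite_subset[of _ "Pow A"]) (use assms in auto)
next
  show "\<forall>H\<in>{H. H \<subseteq> A \<and> (\<forall>i<k. (y i \<in> H) = x ! i) \<and> (\<forall>j<n. \<exists>!e. e \<in> H \<and> Internal j \<in> e)}
      - {H. H \<subseteq> E \<and> (\<forall>i<k. (y i \<in> H) = x ! i) \<and> (\<forall>j<n. \<exists>!e. e \<in> H \<and> Internal j \<in> e)}.
      prod w H = 0"
  proof
    fix H assume "H \<in> {H. H \<subseteq> A \<and> (\<forall>i<k. (y i \<in> H) = x ! i) \<and> (\<forall>j<n. \<exists>!e. e \<in> H \<and> Internal j \<in> e)}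
      - {H. H \<subseteq> E \<and> (\<forall>i<k. (y i \<in> H) = x ! i) \<and> (\<forall>j<n. \<exists>!e. e \<in> H \<and> Internal j \<in> e)}"
    then have "H \<subseteq> A" "\<not> H \<subseteq> E"
      by blast+
    then obtain e where "e \<in> H" "e \<in> A - E"
      by blast
    then show "prod w H = 0"
      using assms \<open>H \<subseteq> A\<close> by (intro prod_zero) (auto intro: finite_subset)
  qed
qed (use assms in blast)

section \<open>The weighted K_4 as a match-circuit\<close>

lemma less_3_cases: "i < (3::nat) \<Longrightarrow> i = 0 \<or> i = 1 \<or> i = 2"
  by linarith

lemma all_less_3: "(\<forall>i<3::nat. P i) \<longleftrightarrow> P 0 \<and> P 1 \<and> P 2"
  by (auto dest!: less_3_cases)

lemma all_less_4: "(\<forall>i<4::nat. P i) \<longleftrightarrow> P 0 \<and> P 1 \<and> P 2 \<and> P 3"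
  by (auto simp: numeral_eq_Suc less_Suc_eq)

definition terminal :: "nat \<Rightarrow> mvertex set" where
  "terminal i = {External i, Internal i}"

text \<open>The complete graph on four internal vertices, three of which carry a terminal. Its edges come in
  three perfect matchings: the edge from vertex \<open>i\<close> to vertex 3 is called \<open>spoke i\<close>, and the disjoint
  edge is called \<open>rim i\<close>.\<close>

definition spoke :: "nat \<Rightarrow> mvertex set" where
  "spoke i = {Internal i, Internal 3}"

definition rim :: "nat \<Rightarrow> mvertex set" where
  "rim i = {Internal ((i + 1) mod 3), Internal ((i + 2) mod 3)}"

definition K4_edges :: "mvertex set set" where
  "K4_edges = set [terminal 0, terminal 1, terminal 2, spoke 0, spoke 1, spoke 2, rim 0, rim 1, rim 2]"

lemmas edge_defs = terminal_def spoke_def rim_def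

lemma edges_distinct:
  "distinct [terminal 0, terminal 1, terminal 2, spoke 0, spoke 1, spoke 2, rim 0, rim 1, rim 2]"
  by (simp add: edge_defs doubleton_eq_iff)

lemma Internal_edges:
  "{e \<in> K4_edges. Internal 0 \<in> e} = {terminal 0, spoke 0, rim 1, rim 2}"
  "{e \<in> K4_edges. Internal 1 \<in> e} = {terminal 1, spoke 1, rim 0, rim 2}"
  "{e \<in> K4_edges. Internal 2 \<in> e} = {terminal 2, spoke 2, rim 0, rim 1}"
  "{e \<in> K4_edges. Internal 3 \<in> e} = {spoke 0, spoke 1, spoke 2}"
  unfolding K4_edges_def set_filter[symmetric] by (simp_all add: edge_defs)

text \<open>Turns unique covering of a vertex into a computation on its explicit list of incident
  edges.\<close>

lemma Ex1_iff_filter: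
  "distinct xs \<Longrightarrow> (\<exists>!e. e \<in> H \<and> e \<in> set xs) \<longleftrightarrow> length (filter (\<lambda>e. e \<in> H) xs) = 1"
proof (induction xs)
  case (Cons a xs)
  have "(\<exists>!e. e \<in> H \<and> e \<in> set (a # xs)) \<longleftrightarrow>
      (if a \<in> H then \<forall>e\<in>set xs. e \<notin> H else \<exists>!e. e \<in> H \<and> e \<in> set xs)"
    using Cons.prems by auto
  then show ?case
    using Cons by (simp add: filter_empty_conv)
qed auto

text \<open>Vertex 3 carries no terminal, so exactly one spoke i covers it. The two remaining
  vertices are then either joined by rim i or each covered by its own terminal.\<close>

lemma K4_matchings:
  assumes H: "H \<subseteq> K4_edges"
  shows "(\<forall>j<4. \<exists>!e. e \<in> H \<and> Internal j \<in> e) \<longleftrightarrow>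
    H \<in> {{spoke 0, rim 0}, {spoke 1, rim 1}, {spoke 2, rim 2},
      {terminal 1, terminal 2, spoke 0}, {terminal 0, terminal 2, spoke 1}, {terminal 0, terminal 1, spoke 2}}"
proof -
  \<comment> \<open>Opaque names keep simplification from comparing edges as sets of vertices. Their
    distinctness is supplied in both orders, so that each inequality is available in both
    orientations.\<close>
  obtain t0 t1 t2 s0 s1 s2 r0 r1 r2 where names: "t0 = terminal 0" "t1 = terminal 1" "t2 = terminal 2"
    "s0 = spoke 0" "s1 = spoke 1" "s2 = spoke 2" "r0 = rim 0" "r1 = rim 1" "r2 = rim 2"
    by blast
  have dist: "distinct [t0, t1, t2, s0, s1, s2, r0, r1, r2]"
    unfolding names by (rule edges_distinct)
  then have dist_rev: "distinct (rev [t0, t1, t2, s0, s1, s2, r0, r1, r2])"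
    by (simp only: distinct_rev)
  have A: "H \<subseteq> {t0, t1, t2, s0, s1, s2, r0, r1, r2}"
    using H unfolding K4_edges_def list.set names .
  have cover_vertex: "(\<exists>!e. e \<in> H \<and> Internal j \<in> e) \<longleftrightarrow> length (filter (\<lambda>e. e \<in> H) xs) = 1"
    if "{e \<in> K4_edges. Internal j \<in> e} = set xs" "distinct xs" for j xs
  proof -
    have "(\<exists>!e. e \<in> H \<and> Internal j \<in> e) \<longleftrightarrow> (\<exists>!e. e \<in> H \<and> e \<in> set xs)"
      unfolding that(1)[symmetric] using H by (intro arg_cong[of _ _ Ex1] ext) blast
    then show ?thesis
      using Ex1_iff_filter[OF that(2)] by simp
  qed
  have cover: "(\<forall>j<4. \<exists>!e. e \<in> H \<and> Internal j \<in> e) \<longleftrightarrow>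
      length (filter (\<lambda>e. e \<in> H) [t0, s0, r1, r2]) = 1 \<and> length (filter (\<lambda>e. e \<in> H) [t1, s1, r0, r2]) = 1 \<and>
      length (filter (\<lambda>e. e \<in> H) [t2, s2, r0, r1]) = 1 \<and> length (filter (\<lambda>e. e \<in> H) [s0, s1, s2]) = 1"
    unfolding all_less_4
    by (intro arg_cong2[of _ _ _ _ "(\<and>)"] cover_vertex)
      (use dist in \<open>simp_all add: Internal_edges names del: One_nat_def\<close>)
  show ?thesis
    unfolding cover names[symmetric]
  proof
    assume "length (filter (\<lambda>e. e \<in> H) [t0, s0, r1, r2]) = 1 \<and> length (filter (\<lambda>e. e \<in> H) [t1, s1, r0, r2]) = 1 \<and>
      length (filter (\<lambda>e. e \<in> H) [t2, s2, r0, r1]) = 1 \<and> length (filter (\<lambda>e. e \<in> H) [s0, s1, s2]) = 1"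
    then have "filter (\<lambda>e. e \<in> H) [t0, t1, t2, s0, s1, s2, r0, r1, r2]
        \<in> {[s0, r0], [s1, r1], [s2, r2], [t1, t2, s0], [t0, t2, s1], [t0, t1, s2]}"
      by (simp split: if_splits)
    then have "set (filter (\<lambda>e. e \<in> H) [t0, t1, t2, s0, s1, s2, r0, r1, r2])
        \<in> set ` {[s0, r0], [s1, r1], [s2, r2], [t1, t2, s0], [t0, t2, s1], [t0, t1, s2]}"
      by (rule imageI)
    moreover have "set (filter (\<lambda>e. e \<in> H) [t0, t1, t2, s0, s1, s2, r0, r1, r2]) = H"
      unfolding set_filter list.set using A by blast
    ultimately show "H \<in> {{s0, r0}, {s1, r1}, {s2, r2}, {t1, t2, s0}, {t0, t2, s1}, {t0, t1, s2}}"
      by (simp only: image_insert image_empty list.set)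
  next
    assume "H \<in> {{s0, r0}, {s1, r1}, {s2, r2}, {t1, t2, s0}, {t0, t2, s1}, {t0, t1, s2}}"
    then consider "H = {s0, r0}" | "H = {s1, r1}" | "H = {s2, r2}"
      | "H = {t1, t2, s0}" | "H = {t0, t2, s1}" | "H = {t0, t1, s2}"
      unfolding insert_iff empty_iff by argo
    then show "length (filter (\<lambda>e. e \<in> H) [t0, s0, r1, r2]) = 1 \<and> length (filter (\<lambda>e. e \<in> H) [t1, s1, r0, r2]) = 1 \<and>
      length (filter (\<lambda>e. e \<in> H) [t2, s2, r0, r1]) = 1 \<and> length (filter (\<lambda>e. e \<in> H) [s0, s1, s2]) = 1"
      using dist dist_rev by cases simp_all
  qed
qed

lemma K4_edges_wf: "\<forall>e\<in>K4_edges. e \<subseteq> External ` {..<3} \<union> Internal ` {..<4} \<and> card e = 2"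
  by (simp add: K4_edges_def edge_defs)

lemma External_edges:
  "{e \<in> K4_edges. External 0 \<in> e} = {terminal 0}"
  "{e \<in> K4_edges. External 1 \<in> e} = {terminal 1}"
  "{e \<in> K4_edges. External 2 \<in> e} = {terminal 2}"
  unfolding K4_edges_def set_filter[symmetric] by (simp_all add: edge_defs)

lemma terminal_in_K4: "i < 3 \<Longrightarrow> terminal i \<in> K4_edges"
  by (drule less_3_cases) (auto simp: K4_edges_def)

text \<open>Without terminals the three perfect matchings of K_4 add up; with two terminals the
  third terminal vertex must be joined to vertex 3.\<close>

lemma K4_value:
  "circuit_value 3 4 K4_edges terminal w [p, q, r] =
     (if \<not> p \<and> \<not> q \<and> \<not> r
      then w (spoke 0) * w (rim 0) + w (spoke 1) * w (rim 1) + w (spoke 2) * w (rim 2) else 0) +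
     (if \<not> p \<and> q \<and> r then w (terminal 1) * w (terminal 2) * w (spoke 0) else 0) +
     (if p \<and> \<not> q \<and> r then w (terminal 0) * w (terminal 2) * w (spoke 1) else 0) +
     (if p \<and> q \<and> \<not> r then w (terminal 0) * w (terminal 1) * w (spoke 2) else 0)"
proof -
  obtain t0 t1 t2 s0 s1 s2 r0 r1 r2 where names: "t0 = terminal 0" "t1 = terminal 1" "t2 = terminal 2"
    "s0 = spoke 0" "s1 = spoke 1" "s2 = spoke 2" "r0 = rim 0" "r1 = rim 1" "r2 = rim 2"
    by blast
  have dist: "distinct [t0, t1, t2, s0, s1, s2, r0, r1, r2]"
    unfolding names by (rule edges_distinct)
  then have dist_rev: "distinct (rev [t0, t1, t2, s0, s1, s2, r0, r1, r2])"
    by (simp only: distinct_rev)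
  define L where "L = [{s0, r0}, {s1, r1}, {s2, r2}, {t1, t2, s0}, {t0, t2, s1}, {t0, t1, s2}]"
  define P where "P H \<longleftrightarrow> (t0 \<in> H \<longleftrightarrow> p) \<and> (t1 \<in> H \<longleftrightarrow> q) \<and> (t2 \<in> H \<longleftrightarrow> r)" for H
  \<comment> \<open>Membership of these four edges already tells the six matchings apart.\<close>
  have "distinct (map (\<lambda>H. (s0 \<in> H, s1 \<in> H, t0 \<in> H, t1 \<in> H)) L)"
    unfolding L_def using dist dist_rev by simp
  then have "distinct L"
    by (simp add: distinct_map)
  have LK: "set L \<subseteq> Pow K4_edges"
    unfolding L_def names K4_edges_def by simp
  have LC: "(\<forall>j<4. \<exists>!e. e \<in> H \<and> Internal j \<in> e) \<longleftrightarrow> H \<in> set L" if "H \<subseteq> K4_edges" for H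
    unfolding L_def names list.set by (rule K4_matchings[OF that])
  have PT: "(\<forall>i<3. terminal i \<in> H \<longleftrightarrow> [p, q, r] ! i) \<longleftrightarrow> P H" for H
    by (simp add: P_def names all_less_3)
  have LP: "H \<subseteq> K4_edges \<and> P H \<and> (\<forall>j<4. \<exists>!e. e \<in> H \<and> Internal j \<in> e) \<longleftrightarrow> H \<in> set L \<and> P H" for H
  proof (cases "H \<subseteq> K4_edges")
    case True
    then show ?thesis
      unfolding LC[OF True] by argo
  next
    case False
    then have "H \<notin> set L"
      using LK by blast
    then show ?thesis
      using False by argo
  qed
  have "{H. H \<subseteq> K4_edges \<and> (\<forall>i<3. terminal i \<in> H \<longleftrightarrow> [p, q, r] ! i) \<and> (\<forall>j<4. \<exists>!e. e \<in> H \<and> Internal j \<in> e)}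
      = {H \<in> set L. P H}"
    unfolding PT LP ..
  then have "circuit_value 3 4 K4_edges terminal w [p, q, r] = (\<Sum>H\<in>set (filter P L). prod w H)"
    unfolding circuit_value_def set_filter by (rule sum.cong) (rule refl)
  also have "\<dots> = sum_list (map (prod w) (filter P L))"
    using \<open>distinct L\<close> by (intro sum.distinct_set_conv_list distinct_filter)
  also have "\<dots> = (if \<not> p \<and> \<not> q \<and> \<not> r then w s0 * w r0 + w s1 * w r1 + w s2 * w r2 else 0) +
     (if \<not> p \<and> q \<and> r then w t1 * w t2 * w s0 else 0) +
     (if p \<and> \<not> q \<and> r then w t0 * w t2 * w s1 else 0) +
     (if p \<and> q \<and> \<not> r then w t0 * w t1 * w s2 else 0)"
    unfolding L_def P_def using dist dist_rev by (cases p; cases q; cases r; simp)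
  finally show ?thesis
    unfolding names .
qed

text \<open>Here \<open>b\<close> gives the spoke weights and \<open>r\<close> the rim weights. Both
  may vanish, because edges of weight 0 are deleted from the circuit.\<close>

lemma K4_implements:
  fixes b r :: "nat \<Rightarrow> real"
  assumes "\<And>i. 0 \<le> b i" "\<And>i. 0 \<le> r i"
    and f: "\<And>p q s. f [p, q, s] =
      (if \<not> p \<and> \<not> q \<and> \<not> s then b 0 * r 0 + b 1 * r 1 + b 2 * r 2 else 0) +
      (if \<not> p \<and> q \<and> s then b 0 else 0) + (if p \<and> \<not> q \<and> s then b 1 else 0) +
      (if p \<and> q \<and> \<not> s then b 2 else 0)"
  shows "match_implements 3 f"
proof -
  define w where "w e = (if e = spoke 0 then b 0 else if e = spoke 1 then b 1 else if e = spoke 2 then b 2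
    else if e = rim 0 then r 0 else if e = rim 1 then r 1 else if e = rim 2 then r 2 else 1)" for e
  define E where "E = {e \<in> K4_edges. 0 < w e}"
  have w: "w (spoke 0) = b 0" "w (spoke 1) = b 1" "w (spoke 2) = b 2"
    "w (rim 0) = r 0" "w (rim 1) = r 1" "w (rim 2) = r 2"
    "w (terminal 0) = 1" "w (terminal 1) = 1" "w (terminal 2) = 1"
    using edges_distinct distinct_rev[THEN iffD2, OF edges_distinct] by (simp_all add: w_def)
  have wt: "w (terminal i) = 1" if "i < 3" for i
    using less_3_cases[OF that] w(7-9) by (elim disjE) simp_all
  have "{e \<in> K4_edges. External i \<in> e} = {terminal i}" if "i < 3" for i
    using less_3_cases[OF that] by (elim disjE) (simp_all only: External_edges)
  then have "{e \<in> E. External i \<in> e} = {terminal i}" if "i < 3" for i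
    using that wt[OF that] terminal_in_K4[OF that] unfolding E_def by auto
  moreover have "inj_on terminal {..<3}"
    by (auto simp: inj_on_def terminal_def doubleton_eq_iff)
  ultimately have C: "match_circuit 3 4 E terminal w"
    using K4_edges_wf wt unfolding match_circuit_def by (auto simp: E_def)
  have "0 \<le> w e" for e
    using assms(1,2) by (simp add: w_def)
  then have "circuit_value 3 4 E terminal w x = circuit_value 3 4 K4_edges terminal w x" for x
    by (intro circuit_value_superset) (auto simp: E_def K4_edges_def less_le)
  then have "\<forall>x\<in>bits 3. f x = circuit_value 3 4 E terminal w x"
    by (auto simp: ex_bits_3 K4_value w f simp del: One_nat_def)
  then show ?thesis
    using C unfolding match_implements_def by blast
qed

text \<open>A single edge of weight \<open>a\<close> between two internal vertices has exactly one
  perfect matching.\<close>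

lemma nullary_class_M:
  assumes "0 < a"
  shows "mk_bfun 0 (\<lambda>_. a) \<in> class_M"
proof -
  define E where "E = {{Internal 0, Internal 1}}"
  have "match_circuit 0 2 E (\<lambda>_. {}) (\<lambda>_. a)"
    using assms by (auto simp: match_circuit_def E_def)
  moreover have "circuit_value 0 2 E (\<lambda>_. {}) (\<lambda>_. a) [] = a"
  proof -
    have "(\<forall>j<2. \<exists>!e. e \<in> H \<and> Internal j \<in> e) \<longleftrightarrow> H = E" if "H \<subseteq> E" for H
    proof (cases "H = {}")
      case True
      then show ?thesis
        by (simp add: E_def) (metis zero_less_numeral)
    next
      case False
      then have "H = E"
        using that by (auto simp: E_def)
      then show ?thesis
        by (auto simp: E_def less_2_cases_iff)
    qed
    then have "H \<subseteq> E \<and> (\<forall>i<0. {} \<in> H \<longleftrightarrow> [] ! i) \<and> (\<forall>j<2. \<exists>!e. e \<in> H \<and> Internal j \<in> e) \<longleftrightarrow> H = E" for H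
      by (cases "H \<subseteq> E") auto
    then show ?thesis
      unfolding circuit_value_def by (simp only: singleton_conv) (simp add: E_def)
  qed
  moreover have "fourier (mk_bfun 0 (\<lambda>_. a)) [] = a"
    by (simp add: fourier_chr)
  ultimately have "match_implements 0 (fourier (mk_bfun 0 (\<lambda>_. a)))"
    unfolding match_implements_def
    by (intro exI[of _ 2] exI[of _ E] exI[of _ "\<lambda>_. {}"] exI[of _ "\<lambda>_. a"]) simp
  then show ?thesis
    using assms by (simp add: class_M_def mk_bfun_B_all)
qed

lemma constant_in_clone_omega:
  assumes f: "f \<in> B_ar 3" "\<And>x. x \<in> bits 3 \<Longrightarrow> snd f x = a"
    and F: "mk_bfun 0 (\<lambda>_. a) \<in> F"
  shows "f \<in> clone_omega F"
proof -
  define g where "g = add_arg 0 (add_arg 0 (add_arg 0 (mk_bfun 0 (\<lambda>_. a))))"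
  have "g \<in> clone_omega F"
    unfolding g_def by (intro clone_omega.add clone_omega.base[OF F]) simp_all
  have "0 \<le> a"
    using f(2)[of "[False, False, False]"] f(1) by (auto simp: B_ar_iff bits_def)
  then have "g \<in> B_ar 3"
    unfolding g_def
    by (metis B_all_add B_all_iff fst_add_arg fst_mk_bfun le0 mk_bfun_B_all numeral_3_eq_3)
  moreover have "snd g x = a" if "x \<in> bits 3" for x
    using that by (auto simp: g_def ex_bits_3 bits_def del_def)
  ultimately show ?thesis
    using bfun_eqI[OF f(1), of g] f(2) \<open>g \<in> clone_omega F\<close> by simp
qed

text \<open>The transform is determined by its values at 000 and at the three inputs of weight two.
  If it is supported on 000 alone and nonzero there, the spokes of K_4 would have weight 0 and could
  not produce it; the function is then a positive constant.\<close>

lemma ternary_SDP_subset: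
  assumes f: "f \<in> class_SDP" and ar: "f \<in> B_ar 3"
  shows "f \<in> clone_omega class_M"
proof -
  have k: "fst f = 3"
    using ar by (simp add: B_ar_iff)
  define a where "a = fourier f [False, False, False]"
  \<comment> \<open>The input is false exactly at position \<open>i\<close>; indices beyond 2 repeat
    \<open>b 2\<close> as a default.\<close>
  define b where "b i = fourier f [i \<noteq> (0::nat), i \<noteq> 1, i \<noteq> 2 \<and> i < 3]" for i
  have odd: "fourier f [p, q, r] = 0" if "odd (hamming_weight [p, q, r])" for p q r
    using that f k by (intro fourier_self_dual_odd) (auto simp: class_SDP_iff bits_def)
  have nonneg: "0 \<le> fourier f [p, q, r]" for p q r
    using f k by (auto simp: class_SDP_iff fpos_def bits_def)
  have F: "fourier f [p, q, r] = (if \<not> p \<and> \<not> q \<and> \<not> r then a else 0) +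
      (if \<not> p \<and> q \<and> r then b 0 else 0) + (if p \<and> \<not> q \<and> r then b 1 else 0) +
      (if p \<and> q \<and> \<not> r then b 2 else 0)" for p q r
    using odd[of p q r] by (cases p; cases q; cases r) (simp_all add: a_def b_def)
  \<comment> \<open>In \<open>K\<^sub>4\<close>, the rim weights \<open>a * b i / D\<close> solve $\sum_i b_i r_i = a$.\<close>
  define D where "D = b 0 ^ 2 + b 1 ^ 2 + b 2 ^ 2"
  show ?thesis
  proof (cases "a = 0 \<or> D \<noteq> 0")
    case True
    \<comment> \<open>If \<open>D = 0\<close> then \<open>a = 0\<close> in this case, and division
      by zero yields rim weights 0, so the equation still holds.\<close>
    have "b 0 * (a * b 0 / D) + b 1 * (a * b 1 / D) + b 2 * (a * b 2 / D) = a * (b 0 ^ 2 + b 1 ^ 2 + b 2 ^ 2) / D"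
      by (simp add: power2_eq_square add_divide_distrib algebra_simps)
    also have "\<dots> = a"
      using True by (auto simp: D_def[symmetric] simp del: One_nat_def)
    finally have a: "b 0 * (a * b 0 / D) + b 1 * (a * b 1 / D) + b 2 * (a * b 2 / D) = a" .
    have "match_implements 3 (fourier f)"
    proof (rule K4_implements)
      show b: "0 \<le> b i" for i
        using nonneg by (simp add: b_def)
      show "0 \<le> a * b i / D" for i
        using nonneg b by (simp add: a_def D_def)
      show "fourier f [p, q, r] =
        (if \<not> p \<and> \<not> q \<and> \<not> r then b 0 * (a * b 0 / D) + b 1 * (a * b 1 / D) + b 2 * (a * b 2 / D) else 0) +
        (if \<not> p \<and> q \<and> r then b 0 else 0) + (if p \<and> \<not> q \<and> r then b 1 else 0) +
        (if p \<and> q \<and> \<not> r then b 2 else 0)" for p q r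
        unfolding a by (rule F)
    qed
    then have "f \<in> class_M"
      using f k by (simp add: class_M_def class_SDP_iff)
    then show ?thesis
      by (rule clone_omega.base)
  next
    case False
    then have b: "b 0 = 0" "b 1 = 0" "b 2 = 0"
      by (auto simp: D_def add_nonneg_eq_0_iff)
    have "snd f x = a" if "x \<in> bits 3" for x
      using fourier_inversion[of x f] that by (auto simp: k sum_bits_3 F b ex_bits_3 simp del: One_nat_def)
    moreover have "0 < a"
      using nonneg[of False False False] False by (simp add: a_def)
    ultimately show ?thesis
      by (intro constant_in_clone_omega[OF ar, of a] nullary_class_M)
  qed
qed


section \<open>Ferromagnetic Ising functions\<close>

lemma Ising_B_ar: "0 \<le> l \<Longrightarrow> Ising k l \<in> B_ar k"
  unfolding Ising_def by (rule mk_bfun_B_ar) simp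

lemma fst_Ising [simp]: "fst (Ising k l) = k"
  by (simp add: Ising_def)

lemma snd_Ising [simp]:
  "x \<in> bits k \<Longrightarrow> snd (Ising k l) x = (if x = replicate k False \<or> x = replicate k True then 1 else l)"
  by (simp add: Ising_def)

lemma map_Not_eq_iff: "map Not x = y \<longleftrightarrow> x = map Not y"
  by (auto simp: comp_def)

lemma self_dual_Ising: "self_dual (Ising k l)"
  by (auto simp: self_dual_def map_Not_eq_iff)

text \<open>If one of the two inputs is constant, it is the least or greatest tuple, so meet and
  join are the two inputs again and equality holds. Otherwise the left side is \<open>l * l\<close>,
  while every value of the function is at least \<open>l\<close>.\<close>

lemma lsm_Ising:
  assumes "0 \<le> l" "l \<le> 1"
  shows "lsm (Ising k l)"
  unfolding lsm_def fst_Ising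
proof (intro ballI)
  fix x y assume xy: "x \<in> bits k" "y \<in> bits k"
  have const: "map2 (\<and>) (replicate k b) y = (if b then y else replicate k False)"
    "map2 (\<and>) x (replicate k b) = (if b then x else replicate k False)"
    "map2 (\<or>) (replicate k b) y = (if b then replicate k True else y)"
    "map2 (\<or>) x (replicate k b) = (if b then replicate k True else x)" for b
    using xy by (auto simp: bits_def intro!: nth_equalityI)
  have ge: "l \<le> snd (Ising k l) (map2 h x y)" for h
    using xy assms by (simp add: map2_bits)
  show "snd (Ising k l) x * snd (Ising k l) y
      \<le> snd (Ising k l) (map2 (\<and>) x y) * snd (Ising k l) (map2 (\<or>) x y)"
  proof (cases "x \<in> {replicate k False, replicate k True} \<or> y \<in> {replicate k False, replicate k True}")
    case True
    then show ?thesis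
      using xy by (elim disjE insertE emptyE) (simp_all only: const if_True if_False mult.commute order_refl)
  next
    case False
    then show ?thesis
      using mult_mono[OF ge ge] xy assms(1) order_trans[OF assms(1) ge] by simp
  qed
qed

lemma lsm_B_ar_0: "f \<in> B_ar 0 \<Longrightarrow> lsm f"
  by (auto simp: lsm_def B_ar_iff)

lemma self_dual_B_ar_0: "f \<in> B_ar 0 \<Longrightarrow> self_dual f"
  by (auto simp: self_dual_def B_ar_iff)

lemma H_ferro_subset: "H_ferro \<subseteq> {f \<in> B_all. self_dual f}" "H_ferro \<subseteq> {f \<in> B_all. lsm f}"
proof -
  have B: "B_ar k \<subseteq> B_all" for k
    by (auto simp: B_all_def)
  show "H_ferro \<subseteq> {f \<in> B_all. self_dual f}"
    unfolding H_ferro_def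
    by (rule self_dual.clone_omega_subset)
      (use B Ising_B_ar self_dual_Ising self_dual_B_ar_0 in blast)
  show "H_ferro \<subseteq> {f \<in> B_all. lsm f}"
    unfolding H_ferro_def
    by (rule lsm.clone_omega_subset) (use B Ising_B_ar lsm_Ising lsm_B_ar_0 in blast)
qed

lemma I_ferro_subset: "I_ferro \<subseteq> H_ferro"
  unfolding I_ferro_def H_ferro_def by (rule clone_omega_mono) blast

text \<open>\<open>q\<close>, \<open>r\<close>, \<open>s\<close> are the values at 001, 010, 100, and \<open>u\<close>, \<open>v\<close>, \<open>w\<close> are the Ising parameters for the
  argument pairs 01, 02, 12.\<close>

lemma triangle_weights:
  fixes p q r s :: real
  assumes "0 < p" "0 \<le> q" "0 \<le> r" "0 \<le> s" "q \<le> p" "r \<le> p" "s \<le> p"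
    and pq: "r * s \<le> p * q" and pr: "q * s \<le> p * r" and ps: "q * r \<le> p * s"
  obtains u v w where "0 \<le> u" "u \<le> 1" "0 \<le> v" "v \<le> 1" "0 \<le> w" "w \<le> 1"
    "s = p * u * v" "r = p * u * w" "q = p * v * w"
proof -
  \<comment> \<open>The product inequalities force the third value to be positive once two are, so
    in the degenerate cases at least two values vanish.\<close>
  have pos: "0 < q \<Longrightarrow> 0 < r \<Longrightarrow> 0 < s" "0 < q \<Longrightarrow> 0 < s \<Longrightarrow> 0 < r" "0 < r \<Longrightarrow> 0 < s \<Longrightarrow> 0 < q"
    using assms(1) pq pr ps by (metis less_le_trans mult_pos_pos zero_less_mult_pos)+
  have "q = 0 \<or> 0 < q" "r = 0 \<or> 0 < r" "s = 0 \<or> 0 < s"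
    using assms by auto
  then consider "q = 0 \<and> r = 0" | "q = 0 \<and> s = 0" | "r = 0 \<and> s = 0" | "0 < q \<and> 0 < r \<and> 0 < s"
    using pos by blast
  then show ?thesis
  proof cases
    case 1
    then show ?thesis
      using assms by (intro that[of "s / p" 1 0]) auto
  next
    case 2
    then show ?thesis
      using assms by (intro that[of "r / p" 0 1]) auto
  next
    case 3
    then show ?thesis
      using assms by (intro that[of 0 "q / p" 1]) auto
  next
    case 4
    \<comment> \<open>Eliminating \<open>v\<close> and \<open>w\<close> from the three equations
      gives u^2 = r s / (p q), and similarly for the others. The bounds by 1 are then the product
      inequalities.\<close>
    have root: "sqrt (x * z / (p * y)) * sqrt (y * z / (p * x)) = z / p"
      if "0 < x" "0 < y" "0 < z" for x y z
    proof -
      have "x * z / (p * y) * (y * z / (p * x)) = (z / p)\<^sup>2"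
        using that assms(1) by (simp add: power2_eq_square field_simps)
      then show ?thesis
        using that assms(1) by (simp add: real_sqrt_mult[symmetric])
    qed
    show ?thesis
    proof (rule that)
      show "s = p * sqrt (r * s / (p * q)) * sqrt (q * s / (p * r))"
        using root[of r q s] 4 assms(1) by (simp add: mult.assoc)
      show "r = p * sqrt (r * s / (p * q)) * sqrt (q * r / (p * s))"
        using root[of s q r] 4 assms(1) by (simp add: mult_ac)
      show "q = p * sqrt (q * s / (p * r)) * sqrt (q * r / (p * s))"
        using root[of s r q] 4 assms(1) by (simp add: mult_ac)
    qed (use 4 assms in auto)
  qed
qed

text \<open>Up to complement there are four inputs, hence four values. The lattice inequalities
  among them are what \<open>triangle_weights\<close> needs, with the common scale \<open>p\<close>
  supplied by a nullary function.\<close>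

lemma ternary_lsm_subset:
  assumes f: "f \<in> B_ar 3" and sd: "self_dual f" and l: "lsm f"
  shows "f \<in> I_ferro"
proof -
  have k: "fst f = 3" and nonneg: "0 \<le> snd f [a, b, c]" for a b c
    using f by (auto simp: B_ar_iff bits_def)
  have dual: "snd f [\<not> a, \<not> b, \<not> c] = snd f [a, b, c]" for a b c
    using bspec[OF sd[unfolded self_dual_def k] bits_3] by simp
  have lat: "snd f [a, b, c] * snd f [a', b', c']
      \<le> snd f [a \<and> a', b \<and> b', c \<and> c'] * snd f [a \<or> a', b \<or> b', c \<or> c']" for a b c a' b' c'
    using lsmD[OF l, of "[a, b, c]" "[a', b', c']"] by (simp add: k bits_def)
  define p q r s where "p = snd f [False, False, False]" and "q = snd f [False, False, True]"
    and "r = snd f [False, True, False]" and "s = snd f [True, False, False]"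
  have val: "snd f [a, b, c] = (if a = b \<and> b = c then p else if a = b then q else if a = c then r else s)"
    for a b c
    using dual[of a b c] by (cases a; cases b; cases c; simp add: p_def q_def r_def s_def)
  have ge: "0 \<le> p" "0 \<le> q" "0 \<le> r" "0 \<le> s"
    using nonneg by (simp_all add: p_def q_def r_def s_def)
  \<comment> \<open>An input and its complement have meet 000 and join 111.\<close>
  have sq: "q * q \<le> p * p" "r * r \<le> p * p" "s * s \<le> p * p"
    using lat[of False False True True True False] lat[of False True False True False True]
      lat[of True False False False True True] by (simp_all add: val)
  then have le: "q \<le> p" "r \<le> p" "s \<le> p"
    using ge by (auto intro: power2_le_imp_le simp: power2_eq_square)
  \<comment> \<open>Two inputs of weight one have meet 000, and their join is the complement of the
    third.\<close>
  have prod: "r * s \<le> p * q" "q * s \<le> p * r" "q * r \<le> p * s"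
    using lat[of False True False True False False] lat[of False False True True False False]
      lat[of False False True False True False] by (simp_all add: val)
  have B0: "mk_bfun 0 (\<lambda>_. p) \<in> {Ising 2 l | l. 0 \<le> l \<and> l \<le> 1} \<union> B_ar 0"
    using ge(1) by (auto intro: mk_bfun_B_ar)
  show ?thesis
  proof (cases "p = 0")
    case True
    then have "snd f x = p" if "x \<in> bits 3" for x
      using that le ge by (auto simp: ex_bits_3 val)
    then show ?thesis
      unfolding I_ferro_def by (rule constant_in_clone_omega[OF f _ B0])
  next
    case False
    with ge have "0 < p"
      by simp
    then obtain u v w where uvw: "0 \<le> u" "u \<le> 1" "0 \<le> v" "v \<le> 1" "0 \<le> w" "w \<le> 1"
      "s = p * u * v" "r = p * u * w" "q = p * v * w"
      using triangle_weights[of p q r s] ge le prod by blast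
    define C where "C = mk_bfun 3 (\<lambda>_. p)"
    have "C \<in> I_ferro"
      unfolding I_ferro_def using ge(1)
      by (intro constant_in_clone_omega[OF _ _ B0]) (auto simp: C_def mk_bfun_B_ar)
    \<comment> \<open>Making position \<open>i\<close> fictitious leaves the binary Ising function
      on the other two, so \<open>edge 2\<close>, \<open>edge 1\<close>, \<open>edge 0\<close> are
      the sides 01, 02, 12.\<close>
    define edge where "edge i t = add_arg i (Ising 2 t)" for i t
    have edge: "edge i t \<in> I_ferro" "fst (edge i t) = 3" if "0 \<le> t" "t \<le> 1" "i \<le> 2" for i t
      unfolding I_ferro_def edge_def using that
      by (auto intro!: clone_omega.add intro: clone_omega.base)
    have Ising_2: "snd (Ising 2 t) [a, b] = (if a = b then 1 else t)" for t a b
      by (simp add: bits_def numeral_2_eq_2)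
    have snd_edge: "snd (edge 0 t) [a, b, c] = (if b = c then 1 else t)"
      "snd (edge 1 t) [a, b, c] = (if a = c then 1 else t)"
      "snd (edge 2 t) [a, b, c] = (if a = b then 1 else t)" for t a b c
      by (simp_all add: edge_def bits_def del_def Ising_2)
    define g where "g = mult_bfun (mult_bfun (mult_bfun C (edge 2 u)) (edge 1 v)) (edge 0 w)"
    have [simp]: "fst C = 3"
      by (simp add: C_def)
    have g: "g \<in> I_ferro"
      using \<open>C \<in> I_ferro\<close> edge uvw unfolding g_def I_ferro_def
      by (intro clone_omega.mult) auto
    moreover have "fst g = 3"
      by (simp add: g_def)
    ultimately have "g \<in> B_ar 3"
      using I_ferro_subset H_ferro_subset by (auto simp: B_all_iff)
    moreover have "snd f x = snd g x" if "x \<in> bits 3" for x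
      using that by (auto simp: ex_bits_3 g_def C_def snd_edge val uvw(7-9) simp del: One_nat_def)
    ultimately show ?thesis
      using bfun_eqI[OF f, of g] g by simp
  qed
qed


section \<open>Separating functions\<close>

text \<open>Its coefficient at each input of weight two is -1/4, which violates the sign conditions
  of both \<open>class_P\<close> and \<open>class_PN\<close>.\<close>

definition not_all_equal :: bfun where
  "not_all_equal = mk_bfun 3 (\<lambda>x. if x = [False, False, False] \<or> x = [True, True, True] then 0 else 1)"

text \<open>All coefficients of \<open>point False\<close> are 1/8; those of
  \<open>point True\<close> are 1/8 with the sign given by the parity of the input.\<close>

definition point :: "bool \<Rightarrow> bfun" where
  "point b = mk_bfun 3 (\<lambda>x. if x = [b, b, b] then 1 else 0)"

text \<open>A sum of two equalities: adding functions preserves self-duality and Fourier positivity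
  but not log-supermodularity. At 010 and 100 the value is 1, while at their join 110 it is
  0.\<close>

definition equal_count :: bfun where
  "equal_count = mk_bfun 3 (\<lambda>x. of_bool (x ! 0 = x ! 2) + of_bool (x ! 1 = x ! 2))"

lemma separating_B_ar: "not_all_equal \<in> B_ar 3" "point b \<in> B_ar 3" "equal_count \<in> B_ar 3"
  by (auto simp: not_all_equal_def point_def equal_count_def intro: mk_bfun_B_ar)

lemma separating_B_all: "not_all_equal \<in> B_all" "point b \<in> B_all" "equal_count \<in> B_all"
  using separating_B_ar by (auto simp: B_all_def)

lemma fst_separating [simp]: "fst not_all_equal = 3" "fst (point b) = 3" "fst equal_count = 3"
  by (simp_all add: not_all_equal_def point_def equal_count_def)

lemma snd_separating [simp]:
  "snd not_all_equal [x, y, z] = (if x = y \<and> y = z then 0 else 1)"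
  "snd (point b) [x, y, z] = (if x = b \<and> y = b \<and> z = b then 1 else 0)"
  "snd equal_count [x, y, z] = of_bool (x = z) + of_bool (y = z)"
  by (auto simp: not_all_equal_def point_def equal_count_def bits_def)

lemma not_all_equal_SD: "not_all_equal \<in> class_SD"
  by (auto simp: class_SD_iff separating_B_all self_dual_def ex_bits_3)

lemma not_all_equal_not_P: "not_all_equal \<notin> class_P"
proof -
  have "fourier not_all_equal [False, True, True] < 0"
    by (simp add: fourier_chr sum_bits_3)
  then show ?thesis
    unfolding class_P_def by (simp add: not_le) (metis bits_3)
qed

lemma not_all_equal_not_PN: "not_all_equal \<notin> class_PN"
proof -
  have "fourier not_all_equal [False, True, True] < 0"
    by (simp add: fourier_chr sum_bits_3)
  moreover have "even (hamming_weight [False, True, True])"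
    by simp
  ultimately show ?thesis
    unfolding class_PN_def using bits_3 by (metis (no_types, lifting) fst_separating(1) mem_Collect_eq not_le)
qed

lemma point_not_SD: "point b \<notin> class_SD"
proof -
  have "snd (point b) (map Not [b, b, b]) \<noteq> snd (point b) [b, b, b]"
    by simp
  then show ?thesis
    unfolding class_SD_iff self_dual_def fst_separating using bits_3 by blast
qed

lemma point_False_P: "point False \<in> class_P"
  by (auto simp: class_P_iff fpos_def separating_B_all ex_bits_3 fourier_chr sum_bits_3)

lemma point_False_not_PN: "point False \<notin> class_PN"
proof -
  have "0 < fourier (point False) [False, False, True]"
    by (simp add: fourier_chr sum_bits_3)
  moreover have "odd (hamming_weight [False, False, True])"
    by simp
  ultimately show ?thesis
    unfolding class_PN_def using bits_3 by (metis (no_types, lifting) fst_separating(2) mem_Collect_eq not_le)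
qed

lemma point_True_PN: "point True \<in> class_PN"
proof -
  have "(even (hamming_weight [x, y, z]) \<longrightarrow> 0 \<le> fourier (point True) [x, y, z]) \<and>
      (odd (hamming_weight [x, y, z]) \<longrightarrow> fourier (point True) [x, y, z] \<le> 0)" for x y z
    by (cases x; cases y; cases z) (simp_all add: fourier_chr sum_bits_3)
  then show ?thesis
    unfolding class_PN_def by (auto simp: separating_B_all ex_bits_3 simp del: hamming_weight_simps)
qed

lemma equal_count_SDP: "equal_count \<in> class_SDP"
  by (auto simp: class_SDP_iff separating_B_all self_dual_def fpos_def ex_bits_3 fourier_chr sum_bits_3)

lemma equal_count_not_lsm: "\<not> lsm equal_count"
proof
  assume "lsm equal_count"
  from lsmD[OF this, of "[False, True, False]" "[True, False, False]"] show False
    by simp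
qed

lemma not_all_equal_not_lsm: "\<not> lsm not_all_equal"
proof
  assume "lsm not_all_equal"
  from lsmD[OF this, of "[False, True, False]" "[True, False, False]"] show False
    by simp
qed

theorem theorem3p5:
  "ternary class_SDP = ternary (clone_omega class_M) \<and>
   ternary H_ferro = ternary I_ferro \<and>
   distinct [B_ar 3, ternary class_SD, ternary class_P, ternary class_PN, ternary class_SDP, ternary I_ferro]"
proof (intro conjI)
  show "ternary class_SDP = ternary (clone_omega class_M)"
    using ternary_SDP_subset clone_omega_M_subset by (auto simp: ternary_def)
  show "ternary H_ferro = ternary I_ferro"
    using ternary_lsm_subset H_ferro_subset I_ferro_subset by (auto simp: ternary_def)
  have SDP: "class_SDP \<subseteq> class_SD" "class_SDP \<subseteq> class_P"
    by (auto simp: class_SDP_def)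
  have I: "I_ferro \<subseteq> class_SD" "I_ferro \<subseteq> {f. lsm f}"
    using I_ferro_subset H_ferro_subset by (auto simp: class_SD_iff)
  have neq: "A \<noteq> B" if "f \<in> A" "f \<notin> B" for f :: bfun and A B
    using that by blast
  \<comment> \<open>Each separating function settles several pairs at once, since being outside a
    larger class excludes it from the smaller ones. The four together cover all fifteen
    pairs.\<close>
  have NAE: "not_all_equal \<in> B_ar 3" "not_all_equal \<in> ternary class_SD" "not_all_equal \<notin> ternary class_P"
    "not_all_equal \<notin> ternary class_PN" "not_all_equal \<notin> ternary class_SDP" "not_all_equal \<notin> ternary I_ferro"
    using separating_B_ar not_all_equal_SD not_all_equal_not_P not_all_equal_not_PN SDP I
      not_all_equal_not_lsm by (auto simp: ternary_def)
  have F: "point False \<in> B_ar 3" "point False \<notin> ternary class_SD" "point False \<in> ternary class_P"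
    "point False \<notin> ternary class_PN" "point False \<notin> ternary class_SDP" "point False \<notin> ternary I_ferro"
    using separating_B_ar point_not_SD point_False_P point_False_not_PN SDP I by (auto simp: ternary_def)
  have T: "point True \<in> ternary class_PN" "point True \<notin> ternary class_SDP" "point True \<notin> ternary I_ferro"
    using separating_B_ar point_not_SD point_True_PN SDP I by (auto simp: ternary_def)
  have C: "equal_count \<in> ternary class_SDP" "equal_count \<notin> ternary I_ferro"
    using separating_B_ar equal_count_SDP equal_count_not_lsm I by (auto simp: ternary_def)
  show "distinct [B_ar 3, ternary class_SD, ternary class_P, ternary class_PN, ternary class_SDP, ternary I_ferro]"
    using neq[OF F(1,2)] neq[OF NAE(1,3)] neq[OF NAE(1,4)] neq[OF NAE(1,5)] neq[OF NAE(1,6)]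
      neq[OF NAE(2,3)] neq[OF NAE(2,4)] neq[OF NAE(2,5)] neq[OF NAE(2,6)]
      neq[OF F(3,4)] neq[OF F(3,5)] neq[OF F(3,6)] neq[OF T(1,2)] neq[OF T(1,3)] neq[OF C]
    by simp
qed

end
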